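(* Let $f(r):=\mu(B_r)$ for $r>0$. Then the following are equivalent: (a) $\mu$ has the $1$-annular decay property at $x_0$; (b) $f$ is locally absolutely continuous on $(0,\infty)$ and there is a constant $C$ such that $\rho f'(\rho)\le Cf(\rho)$ for a.e. $\rho>0$; (c) $f$ is locally Lipschitz on $(0,\infty)$ and there is a constant $C$ such that $\rho f'(\rho)\le Cf(\rho)$ for a.e. $\rho>0$. If moreover $\mu$ is reverse-doubling at $x_0$ with dilation $\tau>1$ and $X$ supports a $1$-Poincaré inequality at $x_0$, then also the following condition is equivalent to those above: (d) $f$ is locally Lipschitz on $(0,\infty)$ and there is a constant $C\ge1$ such that $\frac1Cf(\rho)\le\rho f'(\rho)\le Cf(\rho)$ for a.e. $\rho$ with $0<\rho<\operatorname{diam}X/(2\tau)$.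
   Context: $X=(X,d,\mu)$ is a metric space equipped with a metric $d$ and a positive complete Borel measure $\mu$ such that $0<\mu(B)<\infty$ for all balls $B\subset X$. Write $B(x,r)=\{y\in X: d(y,x)<r\}$; $x_0\in X$ is a fixed but arbitrary point and $B_r=B(x_0,r)$. For a ball $B=B(x,r)$ and $\lambda>0$, $\lambda B=B(x,\lambda r)$. Annular decay: $\mu$ has the $1$-annular decay property at $x$ if there is a constant $C$ such that $\mu(B(x,R)\setminus B(x,r))\le C(1-r/R)\mu(B(x,R))$ for all radii $0<r<R$. Reverse-doubling: $\mu$ is reverse-doubling at $x$ with dilation $\tau>1$ if there is $\gamma>1$ such that $\mu(B(x,\tau r))\ge\gamma\mu(B(x,r))$ for all $0<r\le\operatorname{diam}X/(2\tau)$. Upper gradients: curves are nonconstant, compact and rectifiable, parameterized by arc length $ds$. A Borel function $g:X\to[0,\infty]$ is an upper gradient of $f:X\to[-\infty,\infty]$ if for all curves $\gamma:[0,l_\gamma]\to X$, $|f(\gamma(0))-f(\gamma(l_\gamma))|\le\int_\gamma g\,ds$, where the left-hand side is considered to be $\infty$ whenever at least one of the terms therein is infinite. Poincaré inequality: $X$ supports a $1$-Poincaré inequality at $x$ if there are constants $C>0$ and $\lambda\ge1$ such that for all balls $B=B(x,r)$, $r>0$, all integrable functions $f$ on $X$ and all upper gradients $g$ of $f$, $\frac1{\mu(B)}\int_B|f-f_B|\,d\mu\le Cr\,\frac1{\mu(\lambda B)}\int_{\lambda B}g\,d\mu$, where $f_B=\frac1{\mu(B)}\int_Bf\,d\mu$.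 *)

theory Defs
  imports "HOL-Analysis.Analysis"
begin

text \<open>The metric space \<open>X\<close> is the universe of a type of class \<^class>\<open>metric_space\<close>. The
  \<open>\<sigma>\<close>-algebra contains the Borel sets, and may be larger, as completeness of \<open>\<mu>\<close> requires.\<close>

locale metric_measure_space = complete_measure M
  for M :: "'a::metric_space measure" +
  assumes space_eq: "space M = UNIV"
    and borel_subset: "sets borel \<subseteq> sets M"
    and ball_pos: "r > 0 \<Longrightarrow> 0 < emeasure M (ball x r)"
    and ball_finite: "r > 0 \<Longrightarrow> emeasure M (ball x r) < \<infinity>"

text \<open>Extended-valued, since the library's \<^const>\<open>diameter\<close> of an unbounded set is \<open>0\<close>.\<close>

definition ediameter :: "'a::metric_space set \<Rightarrow> ennreal" where
  "ediameter S = (SUP x\<in>S. SUP y\<in>S. ennreal (dist x y))"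

definition annular_decay_1_at :: "'a::metric_space measure \<Rightarrow> 'a \<Rightarrow> bool" where
  "annular_decay_1_at M x \<longleftrightarrow>
     (\<exists>C. \<forall>r R. 0 < r \<and> r < R \<longrightarrow>
        measure M (ball x R - ball x r) \<le> C * (1 - r / R) * measure M (ball x R))"

definition reverse_doubling_at :: "'a::metric_space measure \<Rightarrow> 'a \<Rightarrow> real \<Rightarrow> bool" where
  "reverse_doubling_at M x \<tau> \<longleftrightarrow>
     (\<exists>\<gamma>>1. \<forall>r>0. ennreal r \<le> ediameter (UNIV :: 'a set) / ennreal (2 * \<tau>) \<longrightarrow>
        measure M (ball x (\<tau> * r)) \<ge> \<gamma> * measure M (ball x r))"

definition curve_length :: "(real \<Rightarrow> 'a::metric_space) \<Rightarrow> real \<Rightarrow> real \<Rightarrow> ennreal" where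
  "curve_length c a b =
     (SUP ts \<in> {ts. sorted ts \<and> set ts \<subseteq> {a..b}}.
        \<Sum>i<length ts - 1. ennreal (dist (c (ts ! i)) (c (ts ! Suc i))))"

text \<open>A nonconstant compact rectifiable curve of length \<open>l\<close>, parameterized by arc length;
  \<open>l > 0\<close> is nonconstancy.\<close>

definition arc_length_curve :: "real \<Rightarrow> (real \<Rightarrow> 'a::metric_space) \<Rightarrow> bool" where
  "arc_length_curve l c \<longleftrightarrow> l > 0 \<and> continuous_on {0..l} c \<and>
     (\<forall>s t. 0 \<le> s \<and> s \<le> t \<and> t \<le> l \<longrightarrow> curve_length c s t = ennreal (t - s))"

definition upper_gradient :: "('a::metric_space \<Rightarrow> ennreal) \<Rightarrow> ('a \<Rightarrow> ereal) \<Rightarrow> bool" where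
  "upper_gradient g f \<longleftrightarrow> g \<in> borel_measurable borel \<and>
     (\<forall>l c. arc_length_curve l c \<longrightarrow>
        (if \<bar>f (c 0)\<bar> = \<infinity> \<or> \<bar>f (c l)\<bar> = \<infinity> then \<infinity> else e2ennreal \<bar>f (c 0) - f (c l)\<bar>)
          \<le> (\<integral>\<^sup>+ t\<in>{0..l}. g (c t) \<partial>lborel))"

definition integrable_ereal :: "'a measure \<Rightarrow> ('a \<Rightarrow> ereal) \<Rightarrow> bool" where
  "integrable_ereal M f \<longleftrightarrow>
     f \<in> borel_measurable M \<and> (\<integral>\<^sup>+ x. e2ennreal \<bar>f x\<bar> \<partial>M) < \<infinity>"

text \<open>An integrable function is finite almost everywhere, so \<^const>\<open>real_of_ereal\<close> (which sends
  infinite values to \<open>0\<close>) does not affect the integral.\<close>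

definition mean_value :: "'a measure \<Rightarrow> 'a set \<Rightarrow> ('a \<Rightarrow> ereal) \<Rightarrow> real" where
  "mean_value M B f = (LINT x:B|M. real_of_ereal (f x)) / measure M B"

definition poincare_1_at :: "'a::metric_space measure \<Rightarrow> 'a \<Rightarrow> bool" where
  "poincare_1_at M x \<longleftrightarrow>
     (\<exists>C \<Lambda>. C > 0 \<and> \<Lambda> \<ge> 1 \<and>
        (\<forall>r>0. \<forall>f g. integrable_ereal M f \<and> upper_gradient g f \<longrightarrow>
           (\<integral>\<^sup>+ y\<in>ball x r. e2ennreal \<bar>f y - ereal (mean_value M (ball x r) f)\<bar> \<partial>M)
               / emeasure M (ball x r)
             \<le> ennreal (C * r) *
               ((\<integral>\<^sup>+ y\<in>ball x (\<Lambda> * r). g y \<partial>M) / emeasure M (ball x (\<Lambda> * r)))))"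

definition absolutely_continuous_on_interval :: "real \<Rightarrow> real \<Rightarrow> (real \<Rightarrow> real) \<Rightarrow> bool" where
  "absolutely_continuous_on_interval a b f \<longleftrightarrow>
     (\<forall>\<epsilon>>0. \<exists>\<delta>>0. \<forall>(n::nat) l u.
        (\<forall>i<n. a \<le> l i \<and> l i \<le> u i \<and> u i \<le> b) \<and>
        (\<forall>i<n. \<forall>j<n. i \<noteq> j \<longrightarrow> {l i<..<u i} \<inter> {l j<..<u j} = {}) \<and>
        (\<Sum>i<n. u i - l i) < \<delta> \<longrightarrow>
        (\<Sum>i<n. \<bar>f (u i) - f (l i)\<bar>) < \<epsilon>)"

definition locally_absolutely_continuous_on :: "real set \<Rightarrow> (real \<Rightarrow> real) \<Rightarrow> bool" where
  "locally_absolutely_continuous_on S f \<longleftrightarrow>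
     (\<forall>a b. a \<le> b \<and> {a..b} \<subseteq> S \<longrightarrow> absolutely_continuous_on_interval a b f)"

definition locally_lipschitz_on :: "'a::metric_space set \<Rightarrow> ('a \<Rightarrow> 'b::metric_space) \<Rightarrow> bool" where
  "locally_lipschitz_on S f \<longleftrightarrow> (\<forall>x\<in>S. \<exists>u>0. \<exists>L. L-lipschitz_on (cball x u \<inter> S) f)"

end

theory Submission
  imports Defs
begin

text \<open>Annular decay says that the difference quotients of \<open>f\<close> on \<open>[r, R]\<close> are at most \<open>C f(R) / R\<close>:
  this gives the Lipschitz bound and, at points of differentiability, the bound on \<open>\<rho> f'(\<rho>)\<close>; monotone
  Lipschitz functions are differentiable almost everywhere by a Vitali covering argument. Conversely,
  absolute continuity lets one integrate \<open>f' \<le> C f(R) / r\<close> over \<open>[r, R]\<close>. For the lower bound, apply the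
  Poincare inequality on \<open>B(x\<^sub>0, \<tau> r)\<close> to a cutoff that drops from \<open>1\<close> to \<open>0\<close> across the annulus
  between \<open>r\<close> and \<open>r + h\<close>: reverse doubling bounds the mean oscillation from below, the right-hand side is
  a multiple of \<open>(f(r + h) - f(r)) / h\<close>, and \<open>h\<close> tends to \<open>0\<close>.\<close>

section \<open>Almost everywhere differentiability of monotone Lipschitz functions\<close>

text \<open>The covering argument is run not on \<open>f\<close> but on a map \<open>H\<close>
  obtained by adding the identity to a clamped copy of \<open>f\<close>. Such an \<open>H\<close> is
  a bi-Lipschitz bijection of the line, so one estimate, applied to \<open>H\<close> and to its
  inverse, treats small and large difference quotients alike.

  The Poincare step must yield a constant independent of \<open>h\<close> and of the dilation
  \<open>\<Lambda>\<close>. The mean value of the cutoff is never computed, because the oscillation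
  bound holds about every constant. The factor \<open>f (\<Lambda> * R)\<close> stands in a
  denominator, so once the derivative is known to be nonnegative it may be lowered to
  \<open>f R\<close>, which then cancels. This leaves
  \<open>min 1 (\<gamma> - 1) / (C * \<tau>)\<close>, where \<open>\<gamma> - 1\<close> measures the
  mass that reverse doubling puts outside the inner ball and \<open>\<tau>\<close> comes from
  \<open>R = \<tau> * r\<close>.\<close>

lemma emeasure_image_le_of_Dini_bound:
  fixes H :: "real \<Rightarrow> real"
  assumes H: "strict_mono H" "continuous_on UNIV H"
    and null: "\<And>N. negligible N \<Longrightarrow> negligible (H ` N)"
    and E: "E \<in> sets borel" "H ` E \<in> sets borel"
    and p: "p > 0"
    and dini: "\<And>x d. x \<in> E \<Longrightarrow> d > 0 \<Longrightarrow> \<exists>y. y \<noteq> x \<and> \<bar>y - x\<bar> < d \<and> (H y - H x) / (y - x) < p"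
  shows "emeasure lborel (H ` E) \<le> ennreal p * emeasure lborel E"
proof -
  have bound: "emeasure lborel (H ` E) \<le> ennreal p * (emeasure lborel E + ennreal e)" if "e > 0" for e
  proof -
    obtain U where U: "open U" "E \<subseteq> U" "emeasure lborel (U - E) \<le> ennreal e"
      using outer_regular_lborel_le[OF E(1) \<open>e > 0\<close>] by auto
    \<comment> \<open>\<open>K\<close> collects the intervals inside \<open>U\<close> over which
      \<open>H\<close> grows by less than \<open>p\<close> times the length. By the Dini hypothesis
      they form a Vitali cover of \<open>E\<close>; a disjoint selection has disjoint image
      intervals, of total length at most \<open>p\<close> times the measure of
      \<open>U\<close>.\<close>
    define K where "K = {(a, b). a < b \<and> {a..b} \<subseteq> U \<and> H b - H a < p * (b - a)}"
    define mid where "mid = (\<lambda>(a::real, b). (a + b) / 2)"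
    define rad where "rad = (\<lambda>(a::real, b). (b - a) / 2)"
    have cball_eq: "cball (mid i) (rad i) = {fst i..snd i}" for i
      by (cases i) (simp add: mid_def rad_def cball_eq_atLeastAtMost field_simps)
    have rad_pos: "0 < rad i" if "i \<in> K" for i
      using that by (auto simp: K_def rad_def)
    have fine: "\<exists>i. i \<in> K \<and> x \<in> cball (mid i) (rad i) \<and> rad i < d" if x: "x \<in> E" and d: "0 < d" for x d
    proof -
      obtain r where r: "r > 0" "ball x r \<subseteq> U"
        using U x open_contains_ball by blast
      obtain y where y: "y \<noteq> x" "\<bar>y - x\<bar> < min r d" "(H y - H x) / (y - x) < p"
        using dini[OF x, of "min r d"] r d by auto
      have sub: "{min x y..max x y} \<subseteq> U"
      proof -
        have "{min x y..max x y} \<subseteq> ball x r"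
          using y by (auto simp: dist_real_def)
        with r show ?thesis by blast
      qed
      have "H (max x y) - H (min x y) < p * (max x y - min x y)"
      proof (cases "x < y")
        case True
        then show ?thesis using y(3) by (simp add: pos_divide_less_eq)
      next
        case False
        then show ?thesis using y(1,3) by (simp add: neg_divide_less_eq algebra_simps)
      qed
      then have "(min x y, max x y) \<in> K"
        using sub y by (auto simp: K_def)
      \<comment> \<open>The point \<open>x\<close> is an endpoint of the interval, not its midpoint;
        the covering theorem only asks that it lie in the closed ball.\<close>
      moreover have "x \<in> cball (mid (min x y, max x y)) (rad (min x y, max x y))"
        unfolding cball_eq by auto
      moreover have "rad (min x y, max x y) < d"
        using y d by (cases "x < y") (simp_all add: rad_def)
      ultimately show ?thesis by blast
    qed
    obtain C where C: "countable C" "C \<subseteq> K"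
      "pairwise (\<lambda>i j. disjnt (cball (mid i) (rad i)) (cball (mid j) (rad j))) C"
      "negligible (E - (\<Union>i\<in>C. cball (mid i) (rad i)))"
      by (rule Vitali_covering_theorem_cballs[of K rad E mid, OF rad_pos fine])
    define N where "N = E - (\<Union>i\<in>C. {fst i..snd i})"
    have disj: "disjoint_family_on (\<lambda>i. {fst i..snd i}) C"
      using C(3) unfolding cball_eq disjoint_family_on_def pairwise_def disjnt_def by auto
    have lt: "fst i < snd i" "{fst i..snd i} \<subseteq> U" "H (snd i) - H (fst i) < p * (snd i - fst i)"
      if "i \<in> C" for i
      using subsetD[OF C(2) that] by (simp_all add: K_def case_prod_unfold)
    have Hle: "H a \<le> H b \<longleftrightarrow> a \<le> b" for a b
      by (rule strict_mono_less_eq[OF H(1)])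
    have Hdisj: "disjoint_family_on (\<lambda>i. {H (fst i)..H (snd i)}) C"
      unfolding disjoint_family_on_def
    proof (intro ballI impI)
      fix i j assume ij: "i \<in> C" "j \<in> C" "i \<noteq> j"
      then have "{fst i..snd i} \<inter> {fst j..snd j} = {}"
        using disj by (auto simp: disjoint_family_on_def)
      then have "snd i < fst j \<or> snd j < fst i"
        using lt[OF ij(1)] lt[OF ij(2)] by (auto simp: Int_atLeastAtMost)
      then show "{H (fst i)..H (snd i)} \<inter> {H (fst j)..H (snd j)} = {}"
        using strict_monoD[OF H(1)] by fastforce
    qed
    \<comment> \<open>The image of the uncovered part \<open>N\<close> is known only to be Lebesgue
      null, so the estimate is carried out in the completed measure and returns to
      \<open>lborel\<close> at Borel sets.\<close>
    have negN: "negligible (H ` N)"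
      using null C(4) unfolding N_def cball_eq by blast
    have sets_N: "H ` N \<in> sets lebesgue"
      using negN by (simp add: negligible_iff_null_sets null_sets_def)
    have sub: "H ` E \<subseteq> (\<Union>i\<in>C. {H (fst i)..H (snd i)}) \<union> H ` N"
    proof (rule image_subsetI)
      fix x assume "x \<in> E"
      then show "H x \<in> (\<Union>i\<in>C. {H (fst i)..H (snd i)}) \<union> H ` N"
        by (cases "x \<in> N") (auto simp: N_def Hle)
    qed
    have "emeasure lborel (H ` E) = emeasure lebesgue (H ` E)"
      using E by simp
    also have "\<dots> \<le> emeasure lebesgue ((\<Union>i\<in>C. {H (fst i)..H (snd i)}) \<union> H ` N)"
      using sub sets_N C(1) by (intro emeasure_mono sets.Un sets.countable_UN') auto
    also have "\<dots> \<le> emeasure lebesgue (\<Union>i\<in>C. {H (fst i)..H (snd i)}) + emeasure lebesgue (H ` N)"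
      using sets_N C(1) by (intro emeasure_subadditive sets.countable_UN') auto
    also have "emeasure lebesgue (H ` N) = 0"
      using negN by (simp add: negligible_iff_null_sets null_sets_def)
    also have "emeasure lebesgue (\<Union>i\<in>C. {H (fst i)..H (snd i)})
        = (\<integral>\<^sup>+i. emeasure lebesgue {H (fst i)..H (snd i)} \<partial>count_space C)"
      using C(1) Hdisj by (intro emeasure_UN_countable) auto
    also have "\<dots> \<le> (\<integral>\<^sup>+i. ennreal p * emeasure lebesgue {fst i..snd i} \<partial>count_space C)"
    proof (intro nn_integral_mono)
      fix i assume "i \<in> space (count_space C)"
      then have i: "i \<in> C" by simp
      have "H (fst i) \<le> H (snd i)" using lt(1)[OF i] by (simp add: Hle)
      then show "emeasure lebesgue {H (fst i)..H (snd i)} \<le> ennreal p * emeasure lebesgue {fst i..snd i}"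
        using lt[OF i] p by (auto simp: ennreal_mult[symmetric] intro!: ennreal_leI)
    qed
    also have "\<dots> = ennreal p * (\<integral>\<^sup>+i. emeasure lebesgue {fst i..snd i} \<partial>count_space C)"
      by (intro nn_integral_cmult) auto
    also have "(\<integral>\<^sup>+i. emeasure lebesgue {fst i..snd i} \<partial>count_space C) = emeasure lebesgue (\<Union>i\<in>C. {fst i..snd i})"
      using C(1) disj by (intro emeasure_UN_countable[symmetric]) auto
    also have "\<dots> \<le> emeasure lebesgue U"
      using lt(2) U(1) by (intro emeasure_mono UN_least) (auto simp del: atLeastatMost_subset_iff)
    also have "emeasure lebesgue U = emeasure lborel (E \<union> (U - E))"
      using U(1,2) by (simp add: Un_absorb1)
    also have "\<dots> \<le> emeasure lborel E + emeasure lborel (U - E)"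
      using U(1) E by (intro emeasure_subadditive) auto
    also have "\<dots> \<le> emeasure lborel E + ennreal e"
      using U by (intro add_left_mono) auto
    finally show ?thesis
      using p by (simp add: mult_left_mono)
  qed
  show ?thesis
  proof (cases "emeasure lborel E = \<infinity>")
    case True
    then show ?thesis using p by (simp add: ennreal_mult_top)
  next
    case False
    show ?thesis
    proof (rule ennreal_le_epsilon)
      fix e :: real assume e: "0 < e"
      have "emeasure lborel (H ` E) \<le> ennreal p * (emeasure lborel E + ennreal (e / p))"
        using bound[of "e / p"] e p by simp
      also have "\<dots> = ennreal p * emeasure lborel E + ennreal e"
        using e p by (simp add: distrib_left ennreal_mult[symmetric])
      finally show "emeasure lborel (H ` E) \<le> ennreal p * emeasure lborel E + ennreal e" .
    qed
  qed
qed

text \<open>Apply the covering estimate to \<open>H\<close> on the exceptional set \<open>E\<close> and to \<open>H\<inverse>\<close> on \<open>H ` E\<close>: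
  together they give \<open>q \<cdot> |E| \<le> |H ` E| \<le> p \<cdot> |E|\<close>.\<close>

lemma negligible_Dini_gap:
  fixes H :: "real \<Rightarrow> real"
  assumes expand: "\<And>x y. x \<le> y \<Longrightarrow> y - x \<le> H y - H x"
    and lip: "L-lipschitz_on UNIV H"
    and pq: "0 < p" "p < q"
  defines "E \<equiv> {x. (\<forall>d>0. \<exists>y. y \<noteq> x \<and> \<bar>y - x\<bar> < d \<and> (H y - H x) / (y - x) < p) \<and>
                   (\<forall>d>0. \<exists>y. y \<noteq> x \<and> \<bar>y - x\<bar> < d \<and> (H y - H x) / (y - x) > q)}"
  shows "negligible E"
proof -
  have cont: "continuous_on UNIV H"
    by (rule lipschitz_on_continuous_on[OF lip])
  have mono: "strict_mono H"
    using expand by (intro strict_monoI) (smt (verit))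
  have "\<exists>x. H x = y" for y
  proof -
    define m where "m = \<bar>y - H 0\<bar>"
    have "H (- m) \<le> y" "y \<le> H m"
      using expand[of "-m" 0] expand[of 0 m] by (auto simp: m_def)
    then show ?thesis
      using IVT'[of H "-m" y m] continuous_on_subset[OF cont] by (auto simp: m_def)
  qed
  then have surj: "surj H" by (metis surjI)
  have inj: "inj H" using mono by (rule strict_mono_imp_inj_on)
  define K where "K = inv H"
  have KH: "K (H x) = x" and HK: "H (K x) = x" for x
    using inj surj by (auto simp: K_def inv_f_f surj_f_inv_f)
  have K_mono: "strict_mono K"
    by (rule strict_monoI) (metis HK mono strict_mono_less)
  \<comment> \<open>The expansion inequality for \<open>H\<close> is the Lipschitz bound with
    constant 1 for its inverse.\<close>
  have K_lip: "1-lipschitz_on UNIV K"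
  proof (rule lipschitz_onI)
    fix x y :: real
    show "dist (K x) (K y) \<le> 1 * dist x y"
      using expand[of "K x" "K y"] expand[of "K y" "K x"]
      by (cases "K x \<le> K y") (simp_all add: HK dist_real_def)
  qed simp
  have K_cont: "continuous_on UNIV K"
    by (rule lipschitz_on_continuous_on[OF K_lip])
  have null: "negligible (G ` N)" if "C-lipschitz_on UNIV G" "negligible N" for C N and G :: "real \<Rightarrow> real"
  proof (rule negligible_locally_Lipschitz_image[OF _ that(2)])
    fix x
    show "\<exists>T B. open T \<and> x \<in> T \<and> (\<forall>y\<in>N \<inter> T. norm (G y - G x) \<le> B * norm (y - x))"
      using lipschitz_on_normD[OF that(1)] by (intro exI[of _ UNIV] exI[of _ C]) auto
  qed simp
  \<comment> \<open>Taking the sign \<open>s\<close> to be \<open>1\<close> or \<open>-1\<close>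
    lets one statement serve both conditions defining \<open>E\<close>. For fixed \<open>y\<close>
    the condition on \<open>x\<close> is open, and letting \<open>d\<close> run through
    \<open>1 / Suc n\<close> makes \<open>E\<close> a countable intersection of open sets.\<close>
  have open_gap: "open {x. \<exists>y. y \<noteq> x \<and> \<bar>y - x\<bar> < d \<and> s * ((H y - H x) / (y - x)) < s * c}" for d s c
  proof -
    have "open {x. y \<noteq> x \<and> \<bar>y - x\<bar> < d \<and> s * ((H y - H x) / (y - x)) < s * c}" for y
    proof -
      have o: "open ({x. \<bar>y - x\<bar> < d} - {y})"
        by (intro open_Diff open_Collect_less continuous_intros closed_singleton)
      have "continuous_on ({x. \<bar>y - x\<bar> < d} - {y}) (\<lambda>x. s * ((H y - H x) / (y - x)))"
        using continuous_on_subset[OF cont] by (intro continuous_intros) auto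
      from continuous_open_preimage[OF this o, of "{..<s * c}"]
      have "open (({x. \<bar>y - x\<bar> < d} - {y}) \<inter> (\<lambda>x. s * ((H y - H x) / (y - x))) -` {..<s * c})"
        by simp
      then show ?thesis
        by (rule back_subst[where P="open"]) auto
    qed
    then have "open (\<Union>y. {x. y \<noteq> x \<and> \<bar>y - x\<bar> < d \<and> s * ((H y - H x) / (y - x)) < s * c})"
      by blast
    then show ?thesis
      by (rule back_subst[where P="open"]) auto
  qed
  have borel_gap: "{x. \<forall>d>0. \<exists>y. y \<noteq> x \<and> \<bar>y - x\<bar> < d \<and> s * ((H y - H x) / (y - x)) < s * c} \<in> sets borel" for s c
  proof -
    have "{x. \<forall>d>0. \<exists>y. y \<noteq> x \<and> \<bar>y - x\<bar> < d \<and> s * ((H y - H x) / (y - x)) < s * c}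
      = (\<Inter>n. {x. \<exists>y. y \<noteq> x \<and> \<bar>y - x\<bar> < 1 / Suc n \<and> s * ((H y - H x) / (y - x)) < s * c})"
      (is "?A = ?B")
    proof
      show "?B \<subseteq> ?A"
      proof (intro subsetI CollectI allI impI)
        fix x d :: real assume x: "x \<in> ?B" and "0 < d"
        obtain n where n: "1 / Suc n < d"
          using nat_approx_posE[OF \<open>0 < d\<close>] by metis
        obtain y where "y \<noteq> x" "\<bar>y - x\<bar> < 1 / Suc n" "s * ((H y - H x) / (y - x)) < s * c"
          using x by blast
        with n show "\<exists>y. y \<noteq> x \<and> \<bar>y - x\<bar> < d \<and> s * ((H y - H x) / (y - x)) < s * c"
          by (intro exI[of _ y]) simp
      qed
    qed auto
    also have "\<dots> \<in> sets borel"
      using open_gap by (intro sets.countable_INT) auto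
    finally show ?thesis .
  qed
  have E_borel: "E \<in> sets borel"
  proof -
    have "E = {x. \<forall>d>0. \<exists>y. y \<noteq> x \<and> \<bar>y - x\<bar> < d \<and> 1 * ((H y - H x) / (y - x)) < 1 * p}
       \<inter> {x. \<forall>d>0. \<exists>y. y \<noteq> x \<and> \<bar>y - x\<bar> < d \<and> (-1) * ((H y - H x) / (y - x)) < (-1) * q}"
      unfolding E_def mult_1 mult_minus1 neg_less_iff_less by auto
    then show ?thesis using borel_gap[of 1 p] borel_gap[of "-1" q] by simp
  qed
  \<comment> \<open>On bounded pieces the measure \<open>m\<close> is finite, so that
    \<open>m \<le> p / q * m\<close> with \<open>p < q\<close> forces \<open>m = 0\<close>.\<close>
  have "negligible (E \<inter> {-real n<..<real n})" for n
  proof -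
    define A where "A = E \<inter> {-real n<..<real n}"
    have A: "A \<in> sets borel" using E_borel by (simp add: A_def)
    have "H ` A = K -` A"
      using KH HK by (auto simp: image_iff) metis
    then have HA: "H ` A \<in> sets borel"
      using measurable_sets[OF borel_measurable_continuous_onI[OF K_cont] A] by simp
    have KHA: "K ` H ` A = A" by (auto simp: KH image_image)
    have 1: "emeasure lborel (H ` A) \<le> ennreal p * emeasure lborel A"
      using null[OF lip] pq by (intro emeasure_image_le_of_Dini_bound mono cont A HA) (auto simp: A_def E_def)
    have 2: "emeasure lborel (K ` H ` A) \<le> ennreal (1 / q) * emeasure lborel (H ` A)"
    proof (rule emeasure_image_le_of_Dini_bound[OF K_mono K_cont null[OF K_lip] HA])
      show "K ` H ` A \<in> sets borel" using A KHA by simp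
      show "0 < 1 / q" using pq by simp
      fix z d :: real assume "z \<in> H ` A" and d: "0 < d"
      then obtain x where x: "x \<in> E" "z = H x" by (auto simp: A_def)
      \<comment> \<open>A displacement below \<open>d / (\<bar>L\<bar> + 1)\<close> moves the image
        by less than \<open>d\<close>. The quotient of the inverse is the reciprocal of that of
        \<open>H\<close>, so above \<open>q\<close> becomes below \<open>1 / q\<close>.\<close>
      have "d / (\<bar>L\<bar> + 1) > 0" using d by simp
      then obtain y where y: "y \<noteq> x" "\<bar>y - x\<bar> < d / (\<bar>L\<bar> + 1)" "(H y - H x) / (y - x) > q"
        using x(1) unfolding E_def by blast
      have ne: "H y \<noteq> H x" using y(1) inj by (auto dest: injD)
      have "\<bar>H y - H x\<bar> \<le> L * \<bar>y - x\<bar>"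
        using lipschitz_on_normD[OF lip, of y x] by simp
      also have "\<dots> \<le> (\<bar>L\<bar> + 1) * \<bar>y - x\<bar>" by (intro mult_right_mono) auto
      also have "\<dots> < d" using y(2) by (simp add: field_simps)
      finally have "\<bar>H y - z\<bar> < d" using x by simp
      moreover have "(K (H y) - K z) / (H y - z) < 1 / q"
      proof -
        have "(K (H y) - K z) / (H y - z) = 1 / ((H y - H x) / (y - x))"
          by (simp add: KH x)
        also have "\<dots> < 1 / q"
          using y pq by (intro divide_strict_left_mono mult_pos_pos) auto
        finally show ?thesis .
      qed
      ultimately show "\<exists>y. y \<noteq> z \<and> \<bar>y - z\<bar> < d \<and> (K y - K z) / (y - z) < 1 / q"
        using ne x by blast
    qed
    have fin: "emeasure lborel A < \<infinity>"
    proof -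
      have "emeasure lborel A \<le> emeasure lborel {-real n<..<real n}"
        by (intro emeasure_mono) (auto simp: A_def)
      also have "\<dots> < \<infinity>" by simp
      finally show ?thesis .
    qed
    then obtain m where m: "emeasure lborel A = ennreal m" "m \<ge> 0"
      by (cases "emeasure lborel A") auto
    have "emeasure lborel A \<le> ennreal (1 / q) * emeasure lborel (H ` A)" using 2 KHA by simp
    also have "\<dots> \<le> ennreal (1 / q) * (ennreal p * emeasure lborel A)"
      by (intro mult_left_mono 1) auto
    also have "\<dots> = ennreal (p / q * m)"
      using pq m by (simp add: ennreal_mult[symmetric])
    finally have "m \<le> p / q * m" using m pq by (simp add: ennreal_le_iff)
    then have "m * q \<le> p * m" using pq by (simp add: field_simps)
    then have "m * (q - p) \<le> 0" by (simp add: algebra_simps)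
    then have "m = 0" using m pq by (simp add: mult_le_0_iff)
    then have "emeasure lebesgue A = 0" using m A by simp
    then show ?thesis
      using A unfolding A_def[symmetric] by (subst negligible_iff_emeasure0) auto
  qed
  then have "negligible (\<Union>n. E \<inter> {-real n<..<real n})"
    by (intro negligible_countable_Union) auto
  also have "(\<Union>n. E \<inter> {-real n<..<real n}) = E"
  proof -
    have "x \<in> (\<Union>n. {-real n<..<real n})" for x
      using reals_Archimedean2[of "\<bar>x\<bar>"] by (auto simp: abs_less_iff) (metis minus_less_iff)
    then show ?thesis by auto
  qed
  finally show ?thesis .
qed

text \<open>The difference quotients stay within \<open>[1, L]\<close>, so at a point of
  nondifferentiability their lower limit lies strictly below their upper limit. A rational pair
  \<open>p < q\<close> separates the two, and there are only countably many such pairs.\<close>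

lemma negligible_nondifferentiable_of_expanding_lipschitz:
  fixes H :: "real \<Rightarrow> real"
  assumes expand: "\<And>x y. x \<le> y \<Longrightarrow> y - x \<le> H y - H x"
    and lip: "L-lipschitz_on UNIV H"
  shows "negligible {x. \<not> H differentiable (at x)}"
proof -
  define D where "D = (\<lambda>x y. (H y - H x) / (y - x))"
  define E where "E = (\<lambda>p q. {x. (\<forall>d>0. \<exists>y. y \<noteq> x \<and> \<bar>y - x\<bar> < d \<and> D x y < p) \<and>
                   (\<forall>d>0. \<exists>y. y \<noteq> x \<and> \<bar>y - x\<bar> < d \<and> D x y > q)})"
  have D_ge: "1 \<le> D x y" and D_le: "D x y \<le> L" if "x \<noteq> y" for x y
  proof -
    show "1 \<le> D x y"
      using expand[of x y] expand[of y x] that by (cases "x < y") (auto simp: D_def field_simps)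
    have "\<bar>H y - H x\<bar> \<le> L * \<bar>y - x\<bar>"
      using lipschitz_on_normD[OF lip, of y x] by simp
    then have "\<bar>D x y\<bar> \<le> L" using that by (simp add: D_def field_simps)
    then show "D x y \<le> L" by simp
  qed
  have "{x. \<not> H differentiable (at x)} \<subseteq> (\<Union>p\<in>\<rat> \<inter> {0<..}. \<Union>q\<in>\<rat> \<inter> {p<..}. E p q)"
  proof (rule subsetI, rule ccontr)
    fix x assume nd: "x \<in> {x. \<not> H differentiable (at x)}"
      and "x \<notin> (\<Union>p\<in>\<rat> \<inter> {0<..}. \<Union>q\<in>\<rat> \<inter> {p<..}. E p q)"
    then have nE: "x \<notin> E p q" if "p \<in> \<rat>" "q \<in> \<rat>" "0 < p" "p < q" for p q
      using that by auto
    \<comment> \<open>\<open>S\<close> holds the eventual lower bounds of the quotients near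
      \<open>x\<close>, so \<open>Sup S\<close> is their lower limit, the candidate for the
      derivative.\<close>
    define S where "S = {c. \<exists>d>0. \<forall>y. y \<noteq> x \<and> \<bar>y - x\<bar> < d \<longrightarrow> c \<le> D x y}"
    have 1: "1 \<in> S" using D_ge by (auto simp: S_def intro!: exI[of _ 1])
    have ub: "c \<le> L" if c: "c \<in> S" for c
    proof -
      obtain d where d: "d > 0" "\<forall>y. y \<noteq> x \<and> \<bar>y - x\<bar> < d \<longrightarrow> c \<le> D x y"
        using c by (auto simp: S_def)
      then have "c \<le> D x (x + d / 2)" by simp
      also have "\<dots> \<le> L" using d by (intro D_le) auto
      finally show ?thesis .
    qed
    have bdd: "bdd_above S" using ub by (auto simp: bdd_above_def)
    define l where "l = Sup S"
    have l1: "1 \<le> l" unfolding l_def using 1 bdd by (rule cSup_upper)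
    have "(D x \<longlongrightarrow> l) (at x)"
    proof (rule LIM_I)
      fix e :: real assume e: "e > 0"
      obtain c where c: "c \<in> S" "l - e < c"
        using less_cSup_iff[of S "l - e"] 1 bdd e unfolding l_def by auto
      obtain d1 where d1: "d1 > 0" "\<forall>y. y \<noteq> x \<and> \<bar>y - x\<bar> < d1 \<longrightarrow> c \<le> D x y"
        using c by (auto simp: S_def)
      obtain p where p: "p \<in> \<rat>" "l < p" "p < l + e" using Rats_dense_in_real[of l "l + e"] e by auto
      obtain q where q: "q \<in> \<rat>" "p < q" "q < l + e" using Rats_dense_in_real[of p "l + e"] p by auto
      \<comment> \<open>A number above \<open>l\<close> is no eventual lower bound, so quotients
        below \<open>p\<close> occur arbitrarily near \<open>x\<close>; as \<open>x\<close> lies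
        outside \<open>E p q\<close>, the quotients must then stay at most \<open>q\<close> near
        \<open>x\<close>.\<close>
      have "p \<notin> S" using cSup_upper[OF _ bdd, of p] p unfolding l_def by auto
      then have "\<forall>d>0. \<exists>y. y \<noteq> x \<and> \<bar>y - x\<bar> < d \<and> D x y < p"
        unfolding S_def by (force simp: not_le)
      then obtain d2 where d2: "d2 > 0" "\<forall>y. y \<noteq> x \<and> \<bar>y - x\<bar> < d2 \<longrightarrow> D x y \<le> q"
        using nE[of p q] p q l1 unfolding E_def by (force simp: not_less)
      show "\<exists>s>0. \<forall>y. y \<noteq> x \<and> norm (y - x) < s \<longrightarrow> norm (D x y - l) < e"
      proof (intro exI[of _ "min d1 d2"] conjI allI impI)
        show "0 < min d1 d2" using d1 d2 by simp
        fix y assume "y \<noteq> x \<and> norm (y - x) < min d1 d2"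
        then have "c \<le> D x y" "D x y \<le> q" using d1 d2 by auto
        then show "norm (D x y - l) < e" using c q by (simp add: abs_less_iff)
      qed
    qed
    then have "(H has_field_derivative l) (at x)"
      unfolding has_field_derivative_iff D_def .
    then show False using nd by (auto simp: real_differentiable_def)
  qed
  moreover have "negligible (\<Union>p\<in>\<rat> \<inter> {0<..}. \<Union>q\<in>\<rat> \<inter> {p<..}. E p q)"
  proof -
    have E_null: "negligible (E p q)" if "0 < p" "p < q" for p q
      unfolding E_def D_def by (rule negligible_Dini_gap[OF expand lip that])
    have "countable (\<rat> \<inter> {p<..})" for p :: real
      using countable_rat by (rule countable_subset[rotated]) auto
    then show ?thesis
      using E_null countable_rat by (intro negligible_countable_Union) auto
  qed
  ultimately show ?thesis by (rule negligible_subset[rotated])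
qed

text \<open>Clamping to \<open>[a, b]\<close> extends \<open>f\<close> to the line without losing
  monotonicity or the Lipschitz bound, and adding the identity makes the result expanding. Near an
  interior point both changes are undone by subtracting the identity.\<close>

lemma negligible_nondifferentiable_mono_lipschitz:
  fixes f :: "real \<Rightarrow> real"
  assumes mono: "mono_on {a..b} f" and lip: "L-lipschitz_on {a..b} f"
  shows "negligible {x \<in> {a<..<b}. \<not> f differentiable (at x)}"
proof (cases "a < b")
  case True
  define c where "c = (\<lambda>x. max a (min b x))"
  define H where "H = (\<lambda>x. f (c x) + x)"
  have c_in: "c x \<in> {a..b}" for x using True by (auto simp: c_def)
  have expand: "y - x \<le> H y - H x" if "x \<le> y" for x y
  proof -
    have "f (c x) \<le> f (c y)"
      using that by (intro mono_onD[OF mono c_in c_in]) (auto simp: c_def)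
    then show ?thesis by (simp add: H_def)
  qed
  have "1-lipschitz_on UNIV c"
    by (rule lipschitz_onI) (auto simp: c_def dist_real_def)
  then have "(L * 1)-lipschitz_on UNIV (f \<circ> c)"
    using c_in by (intro lipschitz_on_compose lipschitz_on_subset[OF lip]) auto
  then have "(L * 1 + 1)-lipschitz_on UNIV H"
    unfolding H_def comp_def by (intro lipschitz_on_add lipschitz_on_id)
  then have "negligible {x. \<not> H differentiable (at x)}"
    using expand by (intro negligible_nondifferentiable_of_expanding_lipschitz)
  moreover have "f differentiable (at x)" if x: "x \<in> {a<..<b}" and "H differentiable (at x)" for x
  proof -
    obtain D where "(H has_real_derivative D) (at x)"
      using \<open>H differentiable (at x)\<close> real_differentiable_def by blast
    then have "((\<lambda>x. H x - x) has_real_derivative (D - 1)) (at x)"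
      by (auto intro!: derivative_eq_intros)
    then have "(f has_real_derivative (D - 1)) (at x)"
      by (rule has_field_derivative_transform_within_open[where S = "{a<..<b}"])
        (use x in \<open>auto simp: H_def c_def\<close>)
    then show ?thesis by (auto simp: real_differentiable_def)
  qed
  ultimately show ?thesis
    by (auto elim!: negligible_subset)
qed simp

lemma AE_lborel_of_negligible:
  assumes "negligible {x. \<not> P x}"
  shows "AE x in lborel. P x"
proof -
  have "AE x in lebesgue. P x"
    using assms by (intro AE_I'[of "{x. \<not> P x}"]) (auto simp: negligible_iff_null_sets)
  then show ?thesis by (simp add: AE_completion_iff)
qed

lemma negligible_of_AE_lborel:
  assumes "AE x in lborel. P x"
  shows "negligible {x. \<not> P x}"
proof -
  have "AE x in lebesgue. P x"
    using assms by (simp add: AE_completion_iff)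
  then show ?thesis
    by (simp add: negligible_iff_null_sets completion.AE_iff_null_sets)
qed

lemma locally_lipschitz_on_compact:
  assumes "locally_lipschitz_on S f" "compact T" "T \<subseteq> S"
  obtains L where "L-lipschitz_on T f"
proof -
  \<comment> \<open>A dummy time set \<open>{0}\<close> turns \<open>f\<close> into a constant
    family, so that the compactness theorem for time-dependent families applies.\<close>
  have "local_lipschitz {0::real} T (\<lambda>_. f)"
  proof (rule local_lipschitzI)
    fix t :: real and x assume "x \<in> T"
    then obtain u L where "u > 0" "L-lipschitz_on (cball x u \<inter> S) f"
      using assms unfolding locally_lipschitz_on_def by blast
    then show "\<exists>u>0. \<exists>L. \<forall>t\<in>cball t u \<inter> {0::real}. L-lipschitz_on (cball x u \<inter> T) f"
      using assms(3) by (intro exI[of _ u] exI[of _ L] conjI ballI) (auto elim: lipschitz_on_subset)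
  qed
  then obtain L where "\<And>t. t \<in> {0::real} \<Longrightarrow> L-lipschitz_on T f"
    by (rule local_lipschitz_compact_implies_lipschitz) (use assms(2) in auto)
  then show ?thesis
    using that by blast
qed

lemma AE_differentiable_mono_locally_lipschitz:
  fixes f :: "real \<Rightarrow> real"
  assumes mono: "mono_on {0<..} f" and lip: "locally_lipschitz_on {0<..} f"
  shows "AE x in lborel. 0 < x \<longrightarrow> f differentiable (at x)"
proof (rule AE_lborel_of_negligible)
  \<comment> \<open>These intervals exhaust \<open>(0, \<infinity>)\<close> and have compact closure
    in it, so each carries a single Lipschitz constant.\<close>
  let ?I = "\<lambda>n. {1 / Suc n<..<real (Suc n)}"
  have "negligible {x \<in> ?I n. \<not> f differentiable (at x)}" for n
  proof -
    have sub: "{1 / real (Suc n)..real (Suc n)} \<subseteq> {0<..}"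
      by (auto intro: less_le_trans[rotated])
    obtain L where "L-lipschitz_on {1 / real (Suc n)..real (Suc n)} f"
      by (rule locally_lipschitz_on_compact[OF lip compact_Icc sub])
    moreover have "mono_on {1 / real (Suc n)..real (Suc n)} f"
      using mono sub by (rule mono_on_subset)
    ultimately show ?thesis
      by (intro negligible_nondifferentiable_mono_lipschitz)
  qed
  then have "negligible (\<Union>n. {x \<in> ?I n. \<not> f differentiable (at x)})"
    by (intro negligible_countable_Union) auto
  moreover have "{x. \<not> (0 < x \<longrightarrow> f differentiable (at x))} \<subseteq> (\<Union>n. {x \<in> ?I n. \<not> f differentiable (at x)})"
  proof clarsimp
    fix x :: real assume "0 < x"
    obtain n where n: "1 / Suc n < x" using nat_approx_posE[OF \<open>0 < x\<close>] by metis
    obtain m where m: "x < real m" using reals_Archimedean2 by blast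
    have "1 / (1 + real (max n m)) \<le> 1 / Suc n" by (simp add: frac_le)
    then show "\<exists>n. 1 / (1 + real n) < x \<and> x < 1 + real n"
      using n m by (intro exI[of _ "max n m"]) auto
  qed
  ultimately show "negligible {x. \<not> (0 < x \<longrightarrow> f differentiable (at x))}"
    by (rule negligible_subset)
qed

section \<open>Absolutely continuous functions with bounded derivative\<close>

text \<open>Upper half of the straddle lemma: the increment over an interval containing
  \<open>x\<close> is split at \<open>x\<close>, and each part is governed by a difference quotient
  at \<open>x\<close>. Intervals of a tagged division contain their tag but need not start or end
  there.\<close>

lemma deriv_le_straddle:
  fixes f :: "real \<Rightarrow> real"
  assumes D: "(f has_real_derivative D) (at x)" and "D < c"
  obtains d where "d > 0" "\<And>u v. u \<le> x \<Longrightarrow> x \<le> v \<Longrightarrow> x - u < d \<Longrightarrow> v - x < d \<Longrightarrow> f v - f u \<le> c * (v - u)"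
proof -
  have "((\<lambda>y. (f y - f x) / (y - x)) \<longlongrightarrow> D) (at x)"
    using D by (simp add: has_field_derivative_iff)
  then have "\<forall>\<^sub>F y in at x. (f y - f x) / (y - x) < c"
    using \<open>D < c\<close> by (rule order_tendstoD)
  then obtain d where d: "d > 0" "\<And>y. y \<noteq> x \<Longrightarrow> dist y x < d \<Longrightarrow> (f y - f x) / (y - x) < c"
    unfolding eventually_at by blast
  show ?thesis
  proof (rule that[OF d(1)])
    fix u v assume uv: "u \<le> x" "x \<le> v" "x - u < d" "v - x < d"
    have "f v - f x \<le> c * (v - x)"
      using d(2)[of v] uv by (cases "v = x") (auto simp: dist_real_def pos_divide_less_eq)
    moreover have "f x - f u \<le> c * (x - u)"
      using d(2)[of u] uv by (cases "u = x") (auto simp: dist_real_def neg_divide_less_eq algebra_simps)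
    ultimately show "f v - f u \<le> c * (v - u)"
      by (simp add: algebra_simps)
  qed
qed

text \<open>Cousin's lemma: take a tagged division fine for a gauge that keeps intervals tagged in the
  exceptional null set inside a thin open set, where absolute continuity controls the increments.\<close>

lemma absolutely_continuous_increment_le:
  fixes f :: "real \<Rightarrow> real"
  assumes ab: "a \<le> b" and ac: "absolutely_continuous_on_interval a b f" and K: "0 \<le> K"
    and der: "AE x in lborel. a < x \<and> x < b \<longrightarrow> f differentiable (at x) \<and> deriv f x \<le> K"
  shows "f b - f a \<le> K * (b - a)"
proof -
  have bound: "f b - f a \<le> (K + e) * (b - a) + e" if e: "e > 0" for e
  proof -
    obtain \<delta> where \<delta>: "\<delta> > 0" and small: "\<forall>(n::nat) l u.
        (\<forall>i<n. a \<le> l i \<and> l i \<le> u i \<and> u i \<le> b) \<and>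
        (\<forall>i<n. \<forall>j<n. i \<noteq> j \<longrightarrow> {l i<..<u i} \<inter> {l j<..<u j} = {}) \<and>
        (\<Sum>i<n. u i - l i) < \<delta> \<longrightarrow>
        (\<Sum>i<n. \<bar>f (u i) - f (l i)\<bar>) < e"
      using ac[unfolded absolutely_continuous_on_interval_def, THEN spec, THEN mp, OF e] by (elim exE conjE)
    have small: "(\<Sum>i<n. \<bar>f (u i) - f (l i)\<bar>) < e"
      if "\<And>i. i < n \<Longrightarrow> a \<le> l i \<and> l i \<le> u i \<and> u i \<le> b"
        "\<And>i j. i < n \<Longrightarrow> j < n \<Longrightarrow> i \<noteq> j \<Longrightarrow> {l i<..<u i} \<inter> {l j<..<u j} = {}"
        "(\<Sum>i<n. u i - l i) < \<delta>" for n :: nat and l u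
      by (rule small[THEN spec, THEN spec, THEN spec, THEN mp]) (use that in blast)
    \<comment> \<open>The endpoints join the exceptional set because differentiability is assumed
      only strictly inside.\<close>
    define N where "N = insert a (insert b {x. \<not> (a < x \<and> x < b \<longrightarrow> f differentiable (at x) \<and> deriv f x \<le> K)})"
    have "negligible N"
      unfolding N_def using negligible_of_AE_lborel[OF der] by simp
    then have N: "N \<in> null_sets lebesgue" by (simp add: negligible_iff_null_sets)
    then have "N \<in> sets lebesgue" by blast
    then obtain U where U: "open U" "N \<subseteq> U" "emeasure lebesgue (U - N) < ennreal \<delta>"
      using \<delta> by (rule sets_lebesgue_outer_open)
    have "emeasure lebesgue U < ennreal \<delta>"
      using U N by (simp add: emeasure_Diff_null_set)
    have "\<exists>d. x \<in> {a..b} - N \<longrightarrow> d > 0 \<and> (\<forall>u v. u \<le> x \<and> x \<le> v \<and> x - u < d \<and> v - x < d \<longrightarrow> f v - f u \<le> (K + e) * (v - u))" for x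
    proof (cases "x \<in> {a..b} - N")
      case True
      then have "f differentiable (at x)" "deriv f x < K + e" using e by (auto simp: N_def)
      then obtain d where "d > 0" "\<And>u v. u \<le> x \<Longrightarrow> x \<le> v \<Longrightarrow> x - u < d \<Longrightarrow> v - x < d \<Longrightarrow> f v - f u \<le> (K + e) * (v - u)"
        using deriv_le_straddle[of f "deriv f x" x "K + e"] DERIV_deriv_iff_real_differentiable by metis
      then show ?thesis by blast
    qed blast
    then obtain d where d: "\<And>x. x \<in> {a..b} - N \<Longrightarrow> d x > 0"
      "\<And>x u v. \<lbrakk>x \<in> {a..b} - N; u \<le> x; x \<le> v; x - u < d x; v - x < d x\<rbrakk> \<Longrightarrow> f v - f u \<le> (K + e) * (v - u)"
      by metis
    define g where "g = (\<lambda>x. if x \<in> N then U else if x \<in> {a..b} then ball x (d x) else UNIV)"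
    have "gauge g"
      using U d(1) by (auto simp: g_def gauge_def)
    then obtain p where p: "p tagged_division_of {a..b}" "g fine p"
      by (rule fine_division_exists_real)
    have fin: "finite p" using p(1) by (rule tagged_division_ofD)
    have pk: "k = {Inf k..Sup k} \<and> Inf k \<le> x \<and> x \<le> Sup k \<and> a \<le> Inf k \<and> Sup k \<le> b \<and> k \<subseteq> g x"
      if xk: "(x, k) \<in> p" for x k
    proof -
      obtain u v where uv: "k = {u..v}"
        using tagged_division_ofD(4)[OF p(1) xk] by (auto simp: box_real)
      have "x \<in> k" "k \<subseteq> {a..b}" using tagged_division_ofD(2,3)[OF p(1) xk] by auto
      moreover have "k \<subseteq> g x" using p(2) xk by (auto simp: fine_def)
      ultimately show ?thesis using uv by auto
    qed
    have disj: "{Inf k<..<Sup k} \<inter> {Inf k'<..<Sup k'} = {}" if "(x, k) \<in> p" "(x', k') \<in> p" "(x, k) \<noteq> (x', k')" for x k x' k'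
    proof -
      have "interior k \<inter> interior k' = {}"
        using tagged_division_ofD(5)[OF p(1) that] .
      then show ?thesis
        using pk[OF that(1)] pk[OF that(2)] by (metis interior_atLeastAtMost_real)
    qed
    define B where "B = {xk \<in> p. fst xk \<in> N}"
    have finB: "finite B" using fin by (simp add: B_def)
    have good: "f (Sup k) - f (Inf k) \<le> (K + e) * (Sup k - Inf k)" if "(x, k) \<in> p - B" for x k
    proof (rule d(2)[of x])
      show x: "x \<in> {a..b} - N" using that pk[of x k] by (auto simp: B_def)
      then have "{Inf k..Sup k} \<subseteq> ball x (d x)" using that pk[of x k] by (auto simp: g_def)
      moreover have *: "Inf k \<le> x" "x \<le> Sup k" using that pk[of x k] by auto
      ultimately have "Inf k \<in> ball x (d x)" "Sup k \<in> ball x (d x)" by (meson atLeastAtMost_iff order_refl order_trans subsetD)+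
      then show "x - Inf k < d x" "Sup k - x < d x" using * by (auto simp: dist_real_def)
    qed (use that pk[of x k] in auto)
    have bad: "(\<Sum>(x, k)\<in>B. \<bar>f (Sup k) - f (Inf k)\<bar>) < e"
    proof -
      \<comment> \<open>Absolute continuity is stated for families indexed by naturals, so the bad
        intervals are enumerated.\<close>
      obtain h where h: "bij_betw h {..<card B} B"
        using finB by (metis bij_betw_from_nat_into_finite)
      have hB: "h i \<in> B" if "i < card B" for i
        using bij_betwE[OF h] that by auto
      have hinj: "h i \<noteq> h j" if "i < card B" "j < card B" "i \<noteq> j" for i j
        using bij_betw_imp_inj_on[OF h] that by (auto dest: inj_onD)
      have "(\<Sum>i<card B. \<bar>f (Sup (snd (h i))) - f (Inf (snd (h i)))\<bar>) < e"
      proof (rule small)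
        fix i assume "i < card B"
        then show "a \<le> Inf (snd (h i)) \<and> Inf (snd (h i)) \<le> Sup (snd (h i)) \<and> Sup (snd (h i)) \<le> b"
          using hB[of i] pk[of "fst (h i)" "snd (h i)"] by (auto simp: B_def)
      next
        fix i j assume "i < card B" "j < card B" "i \<noteq> j"
        then show "{Inf (snd (h i))<..<Sup (snd (h i))} \<inter> {Inf (snd (h j))<..<Sup (snd (h j))} = {}"
          using disj[of "fst (h i)" "snd (h i)" "fst (h j)" "snd (h j)"] hB[of i] hB[of j] hinj[of i j]
          by (simp add: B_def)
      next
        have "ennreal (\<Sum>i<card B. Sup (snd (h i)) - Inf (snd (h i))) = ennreal (\<Sum>xk\<in>B. Sup (snd xk) - Inf (snd xk))"
          using sum.reindex_bij_betw[OF h, of "\<lambda>xk. Sup (snd xk) - Inf (snd xk)"] by simp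
        also have "\<dots> = (\<Sum>xk\<in>B. ennreal (Sup (snd xk) - Inf (snd xk)))"
          using pk by (intro sum_ennreal[symmetric]) (force simp: B_def)
        also have "\<dots> = (\<Sum>xk\<in>B. emeasure lebesgue {Inf (snd xk)<..<Sup (snd xk)})"
          using pk by (intro sum.cong) (force simp: B_def)+
        also have "\<dots> = emeasure lebesgue (\<Union>xk\<in>B. {Inf (snd xk)<..<Sup (snd xk)})"
          using disj finB by (intro sum_emeasure) (auto simp: disjoint_family_on_def B_def)
        also have "\<dots> \<le> emeasure lebesgue U"
        proof (intro emeasure_mono UN_least)
          fix xk assume "xk \<in> B"
          then have "snd xk \<subseteq> U" "snd xk = {Inf (snd xk)..Sup (snd xk)}"
            using pk[of "fst xk" "snd xk"] by (auto simp: B_def g_def)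
          then show "{Inf (snd xk)<..<Sup (snd xk)} \<subseteq> U"
            by (metis greaterThanLessThan_subseteq_atLeastAtMost_iff order_refl subset_trans)
        qed (use U in auto)
        also have "\<dots> < ennreal \<delta>" by fact
        finally show "(\<Sum>i<card B. Sup (snd (h i)) - Inf (snd (h i))) < \<delta>"
          by (meson ennreal_leI not_le)
      qed
      then show ?thesis
        using sum.reindex_bij_betw[OF h, of "\<lambda>xk. \<bar>f (Sup (snd xk)) - f (Inf (snd xk))\<bar>"]
        by (simp add: case_prod_unfold)
    qed
    have "f b - f a = (\<Sum>(x, k)\<in>p. f (Sup k) - f (Inf k))"
      using additive_tagged_division_1[OF ab p(1), of f] by simp
    also have "\<dots> = (\<Sum>(x, k)\<in>p - B. f (Sup k) - f (Inf k)) + (\<Sum>(x, k)\<in>B. f (Sup k) - f (Inf k))"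
      using fin by (intro sum.subset_diff) (auto simp: B_def)
    also have "\<dots> \<le> (\<Sum>(x, k)\<in>p - B. (K + e) * (Sup k - Inf k)) + (\<Sum>(x, k)\<in>B. \<bar>f (Sup k) - f (Inf k)\<bar>)"
      using good by (intro add_mono sum_mono) auto
    \<comment> \<open>Restoring the bad intervals only adds nonnegative terms, and then all lengths
      together sum to \<open>b - a\<close>.\<close>
    also have "(\<Sum>(x, k)\<in>p - B. (K + e) * (Sup k - Inf k)) \<le> (\<Sum>(x, k)\<in>p. (K + e) * (Sup k - Inf k))"
      using fin pk K e by (intro sum_mono2) (force simp: case_prod_unfold)+
    also have "\<dots> = (K + e) * (\<Sum>(x, k)\<in>p. Sup k - Inf k)"
      by (simp add: sum_distrib_left case_prod_unfold)
    also have "(\<Sum>(x, k)\<in>p. Sup k - Inf k) = b - a"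
      using additive_tagged_division_1[OF ab p(1), of "\<lambda>x. x"] by simp
    finally show ?thesis using bad by simp
  qed
  show ?thesis
  proof (rule field_le_epsilon)
    fix e :: real assume "e > 0"
    \<comment> \<open>Chosen so that the two error terms \<open>e' * (b - a)\<close> and
      \<open>e'\<close> add up to \<open>e\<close>.\<close>
    define e' where "e' = e / (b - a + 1)"
    have "e' > 0" using \<open>e > 0\<close> ab by (simp add: e'_def)
    have "e' * (b - a + 1) = e" using ab by (simp add: e'_def)
    with bound[OF \<open>e' > 0\<close>] show "f b - f a \<le> K * (b - a) + e"
      by (simp add: algebra_simps)
  qed
qed

lemma lipschitz_imp_absolutely_continuous:
  fixes f :: "real \<Rightarrow> real"
  assumes "L-lipschitz_on {a..b} f"
  shows "absolutely_continuous_on_interval a b f"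
  unfolding absolutely_continuous_on_interval_def
proof (intro allI impI)
  fix e :: real assume e: "e > 0"
  have L: "L \<ge> 0" using assms by (rule lipschitz_on_nonneg)
  show "\<exists>d>0. \<forall>(n::nat) l u.
        (\<forall>i<n. a \<le> l i \<and> l i \<le> u i \<and> u i \<le> b) \<and>
        (\<forall>i<n. \<forall>j<n. i \<noteq> j \<longrightarrow> {l i<..<u i} \<inter> {l j<..<u j} = {}) \<and>
        (\<Sum>i<n. u i - l i) < d \<longrightarrow>
        (\<Sum>i<n. \<bar>f (u i) - f (l i)\<bar>) < e"
  \<comment> \<open>Dividing by \<open>L + 1\<close> keeps the step size positive even for
    \<open>L = 0\<close>.\<close>
  proof (intro exI[of _ "e / (L + 1)"] conjI allI impI; (elim conjE)?)
    show "0 < e / (L + 1)" using e L by simp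
    fix n :: nat and l u :: "nat \<Rightarrow> real"
    assume lu: "\<forall>i<n. a \<le> l i \<and> l i \<le> u i \<and> u i \<le> b" and s: "(\<Sum>i<n. u i - l i) < e / (L + 1)"
    have "(\<Sum>i<n. \<bar>f (u i) - f (l i)\<bar>) \<le> (\<Sum>i<n. (L + 1) * (u i - l i))"
    proof (rule sum_mono)
      fix i assume i: "i \<in> {..<n}"
      have "\<bar>f (u i) - f (l i)\<bar> \<le> L * (u i - l i)"
        using lipschitz_on_normD[OF assms, of "u i" "l i"] lu i by force
      also have "\<dots> \<le> (L + 1) * (u i - l i)" using lu i by (intro mult_right_mono) auto
      finally show "\<bar>f (u i) - f (l i)\<bar> \<le> (L + 1) * (u i - l i)" .
    qed
    also have "\<dots> = (L + 1) * (\<Sum>i<n. u i - l i)" by (simp add: sum_distrib_left)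
    also have "\<dots> < e" using s L by (simp add: field_simps)
    finally show "(\<Sum>i<n. \<bar>f (u i) - f (l i)\<bar>) < e" .
  qed
qed

lemma locally_lipschitz_imp_locally_absolutely_continuous:
  fixes f :: "real \<Rightarrow> real"
  assumes "locally_lipschitz_on S f"
  shows "locally_absolutely_continuous_on S f"
  unfolding locally_absolutely_continuous_on_def
proof (intro allI impI; elim conjE)
  fix a b assume "{a..b} \<subseteq> S"
  then obtain L where "L-lipschitz_on {a..b} f"
    using locally_lipschitz_on_compact[OF assms compact_Icc] by blast
  then show "absolutely_continuous_on_interval a b f"
    by (rule lipschitz_imp_absolutely_continuous)
qed

section \<open>Growth of the measure of balls\<close>

text \<open>Left quotients are what annular decay controls: with the outer radius \<open>R\<close>
  fixed and \<open>r\<close> increasing to \<open>R\<close>, its right-hand side is the fixed slope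
  \<open>C * f R / R\<close> times \<open>R - r\<close>.\<close>

lemma derivative_le_of_left_quotients_le:
  fixes f :: "real \<Rightarrow> real"
  assumes D: "(f has_real_derivative D) (at x)" and "a < x"
    and le: "\<And>y. a < y \<Longrightarrow> y < x \<Longrightarrow> f x - f y \<le> c * (x - y)"
  shows "D \<le> c"
proof (rule tendsto_upperbound)
  show "((\<lambda>y. (f y - f x) / (y - x)) \<longlongrightarrow> D) (at_left x)"
    using D unfolding has_field_derivative_iff by (rule tendsto_within_subset) simp
  show "\<forall>\<^sub>F y in at_left x. (f y - f x) / (y - x) \<le> c"
    using eventually_at_left_real[OF \<open>a < x\<close>]
  proof eventually_elim
    case (elim y)
    then show ?case using le[of y] by (simp add: neg_divide_le_eq algebra_simps)
  qed
qed simp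

lemma lipschitz_on_derivative_le:
  fixes f :: "real \<Rightarrow> real"
  assumes "L-lipschitz_on {a..b} f" "x \<in> {a<..<b}" "(f has_real_derivative D) (at x)"
  shows "D \<le> L"
proof (rule derivative_le_of_left_quotients_le[OF assms(3)])
  show "a < x" using assms by simp
  fix y assume "a < y" "y < x"
  then show "f x - f y \<le> L * (x - y)"
    using lipschitz_on_normD[OF assms(1), of x y] assms(2) by simp
qed

lemma dist_le_ediameter: "x \<in> S \<Longrightarrow> y \<in> S \<Longrightarrow> ennreal (dist x y) \<le> ediameter S"
  unfolding ediameter_def by (meson SUP_upper2 SUP_upper order_trans)

context metric_measure_space
begin

lemma sets_ball [measurable, simp]: "ball x r \<in> sets M"
  using borel_subset by (meson borel_open open_ball subsetD)

lemma emeasure_ball: "emeasure M (ball x r) = ennreal (measure M (ball x r))"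
proof (cases "r > 0")
  case True
  then show ?thesis using ball_finite[of r x] by (simp add: emeasure_eq_ennreal_measure)
qed (simp add: ball_empty)

lemma fmeasurable_ball [simp]: "ball x r \<in> fmeasurable M"
  by (rule fmeasurableI) (auto simp: emeasure_ball)

lemma measure_ball_pos: "r > 0 \<Longrightarrow> measure M (ball x r) > 0"
  using ball_pos[of r x] by (simp add: emeasure_ball)

lemma measure_ball_mono: "r \<le> s \<Longrightarrow> measure M (ball x r) \<le> measure M (ball x s)"
  by (intro measure_mono_fmeasurable subset_ball) auto

lemma measure_annulus:
  "r \<le> s \<Longrightarrow> measure M (ball x s - ball x r) = measure M (ball x s) - measure M (ball x r)"
  by (intro measurable_measure_Diff subset_ball) auto

lemma emeasure_annulus:
  assumes "r \<le> s"
  shows "emeasure M (ball x s - ball x r) = ennreal (measure M (ball x s) - measure M (ball x r))"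
proof -
  have "ball x s - ball x r \<in> fmeasurable M" by (intro fmeasurable.Diff) auto
  then show ?thesis using assms by (simp add: emeasure_eq_measure2 measure_annulus)
qed

end

locale ball_growth = metric_measure_space M
  for M :: "'a::metric_space measure" +
  fixes x :: 'a and f :: "real \<Rightarrow> real"
  assumes f_eq: "r > 0 \<Longrightarrow> f r = measure M (ball x r)"
begin

lemma f_pos: "r > 0 \<Longrightarrow> f r > 0"
  by (simp add: f_eq measure_ball_pos)

lemma f_mono: "0 < r \<Longrightarrow> r \<le> s \<Longrightarrow> f r \<le> f s"
  by (simp add: f_eq measure_ball_mono)

lemma annular_decay_iff:
  "annular_decay_1_at M x \<longleftrightarrow> (\<exists>C. \<forall>r R. 0 < r \<and> r < R \<longrightarrow> f R - f r \<le> C * (1 - r / R) * f R)"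
  unfolding annular_decay_1_at_def
  by (intro arg_cong[where f=Ex] ext all_cong) (simp add: f_eq measure_annulus)

lemma annular_decay_imp_locally_lipschitz:
  assumes "annular_decay_1_at M x"
  shows "locally_lipschitz_on {0<..} f"
proof -
  obtain C where C: "\<And>r R. 0 < r \<Longrightarrow> r < R \<Longrightarrow> f R - f r \<le> C * (1 - r / R) * f R"
    using assms unfolding annular_decay_iff by blast
  show ?thesis unfolding locally_lipschitz_on_def
  proof (intro ballI exI conjI)
    fix t :: real assume "t \<in> {0<..}"
    then have t: "t > 0" by simp
    \<comment> \<open>The radii compared lie in \<open>[t / 2, 2 * t]\<close>, where
      \<open>f s / s\<close> is at most \<open>f (2 * t) / (t / 2)\<close>; the absolute value
      guards against a negative \<open>C\<close>.\<close>
    define L where "L = \<bar>C\<bar> * f (2 * t) / (t / 2)"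
    show "t / 2 > 0" using t by simp
    have L: "0 \<le> L" using t f_pos[of "2 * t"] by (simp add: L_def)
    have *: "f s - f r \<le> L * (s - r)" if "t / 2 \<le> r" "r \<le> s" "s \<le> 2 * t" for r s
    proof (cases "r < s")
      case True
      have "f s - f r \<le> C * (1 - r / s) * f s"
        using that t True by (intro C) auto
      also have "\<dots> = C * (s - r) * (f s / s)"
        using that t by (simp add: field_simps)
      also have "\<dots> \<le> \<bar>C\<bar> * (s - r) * (f (2 * t) / (t / 2))"
        using that t f_pos[of s] f_mono[of s "2 * t"]
        by (intro mult_mono frac_le mult_right_mono) auto
      finally show ?thesis by (simp add: L_def mult_ac)
    qed (use that in simp)
    show "L-lipschitz_on (cball t (t / 2) \<inter> {0<..}) f"
    proof (rule lipschitz_on_leI)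
      fix r s assume "r \<in> cball t (t / 2) \<inter> {0<..}" "s \<in> cball t (t / 2) \<inter> {0<..}" "r \<le> s"
      then have "dist t r \<le> t / 2" "dist t s \<le> t / 2" "0 < r" by auto
      then have "t / 2 \<le> r" "s \<le> 2 * t" using t unfolding dist_real_def by linarith+
      then have "f s - f r \<le> L * (s - r)" "f r \<le> f s"
        using \<open>r \<le> s\<close> \<open>0 < r\<close> by (auto intro!: * f_mono)
      then show "dist (f r) (f s) \<le> L * dist r s"
        using \<open>r \<le> s\<close> by (simp add: dist_real_def)
    qed (rule L)
  qed
qed

lemma annular_decay_imp_deriv_le:
  assumes "annular_decay_1_at M x"
  obtains C where "\<And>r. r > 0 \<Longrightarrow> f differentiable (at r) \<Longrightarrow> r * deriv f r \<le> C * f r"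
proof -
  obtain C where C: "\<And>r R. 0 < r \<Longrightarrow> r < R \<Longrightarrow> f R - f r \<le> C * (1 - r / R) * f R"
    using assms unfolding annular_decay_iff by blast
  show ?thesis
  proof (rule that)
    fix R :: real assume R: "R > 0" and "f differentiable (at R)"
    then have D: "(f has_real_derivative deriv f R) (at R)"
      by (simp add: DERIV_deriv_iff_real_differentiable)
    have "deriv f R \<le> C * f R / R"
    proof (rule derivative_le_of_left_quotients_le[OF D R])
      fix r assume "0 < r" "r < R"
      with C[OF this] show "f R - f r \<le> C * f R / R * (R - r)"
        by (simp add: field_simps)
    qed
    then show "R * deriv f R \<le> C * f R" using R by (simp add: field_simps)
  qed
qed

lemma annular_decay_imp_AE_deriv_le:
  assumes "annular_decay_1_at M x"
  shows "\<exists>C. AE \<rho> in lborel. 0 < \<rho> \<longrightarrow> f differentiable (at \<rho>) \<and> \<rho> * deriv f \<rho> \<le> C * f \<rho>"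
proof -
  obtain C where C: "\<And>r. r > 0 \<Longrightarrow> f differentiable (at r) \<Longrightarrow> r * deriv f r \<le> C * f r"
    using annular_decay_imp_deriv_le[OF assms] by blast
  have "mono_on {0<..} f" by (rule mono_onI) (simp add: f_mono)
  then have "AE \<rho> in lborel. 0 < \<rho> \<longrightarrow> f differentiable (at \<rho>)"
    using annular_decay_imp_locally_lipschitz[OF assms] by (rule AE_differentiable_mono_locally_lipschitz)
  then show ?thesis
    using C by (intro exI[of _ C]) (auto elim!: eventually_mono)
qed

text \<open>Radii \<open>r < R / 2\<close> need no derivative bound, since there \<open>1 \<le> 2 * (1 - r / R)\<close>.\<close>

lemma AE_deriv_le_imp_annular_decay:
  assumes ac: "locally_absolutely_continuous_on {0<..} f"
    and der: "AE \<rho> in lborel. 0 < \<rho> \<longrightarrow> f differentiable (at \<rho>) \<and> \<rho> * deriv f \<rho> \<le> C * f \<rho>"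
  shows "annular_decay_1_at M x"
  unfolding annular_decay_iff
proof (intro exI allI impI; elim conjE)
  fix r R :: real assume r: "0 < r" "r < R"
  \<comment> \<open>Raising \<open>C\<close> to at least 1 makes it nonnegative, as the comparison
    \<open>C * f t \<le> B * f R\<close> needs, and settles small radii through
    \<open>f R - f r \<le> f R\<close>.\<close>
  define B where "B = max C 1"
  have B: "1 \<le> B" "C \<le> B" by (auto simp: B_def)
  have fR: "f R > 0" and fr: "f r > 0" using f_pos r by auto
  show "f R - f r \<le> 2 * max C 1 * (1 - r / R) * f R"
    unfolding B_def[symmetric]
  proof (cases "R / 2 \<le> r")
    case True
    have "f R - f r \<le> (B * f R / r) * (R - r)"
    proof (rule absolutely_continuous_increment_le)
      show "absolutely_continuous_on_interval r R f"
      proof -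
        have "r \<le> R" "{r..R} \<subseteq> {0<..}" using r by auto
        with ac show ?thesis unfolding locally_absolutely_continuous_on_def by blast
      qed
      show "0 \<le> B * f R / r" using B fR r by simp
      show "AE t in lborel. r < t \<and> t < R \<longrightarrow> f differentiable at t \<and> deriv f t \<le> B * f R / r"
        using der
      proof eventually_elim
        case (elim t)
        show ?case
        proof (intro impI conjI)
          assume t: "r < t \<and> t < R"
          with elim r have *: "f differentiable at t" "t * deriv f t \<le> C * f t" by auto
          show "f differentiable at t" by fact
          have "C * f t \<le> B * f R"
            using B t r f_mono[of t R] f_pos[of t] by (intro mult_mono) auto
          with * have "deriv f t \<le> B * f R / t"
            using t r by (simp add: field_simps)
          also have "\<dots> \<le> B * f R / r"
            using t r B fR by (intro divide_left_mono) auto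
          finally show "deriv f t \<le> B * f R / r" .
        qed
      qed
    qed (use r in simp)
    also have "\<dots> = B * f R * (R - r) * (1 / r)" by simp
    \<comment> \<open>For \<open>R / 2 \<le> r\<close> the factor \<open>1 / r\<close> is at most
      \<open>2 / R\<close>, which accounts for the 2 in the constant.\<close>
    also have "\<dots> \<le> B * f R * (R - r) * (2 / R)"
      using True r B fR by (intro mult_left_mono) (auto simp: field_simps)
    also have "\<dots> = 2 * B * (1 - r / R) * f R"
      using r by (simp add: field_simps)
    finally show "f R - f r \<le> 2 * B * (1 - r / R) * f R" .
  next
    case False
    then have "1 \<le> 2 * (1 - r / R)" using r by (simp add: field_simps)
    then have "1 * 1 \<le> B * (2 * (1 - r / R))" using B by (intro mult_mono) auto
    then have "1 * f R \<le> 2 * B * (1 - r / R) * f R" using fR by (intro mult_right_mono) (auto simp: mult_ac)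
    then show "f R - f r \<le> 2 * B * (1 - r / R) * f R" using fr by linarith
  qed
qed

text \<open>Beyond the diameter \<open>f\<close> is constant, and between \<open>diam / (2 * \<tau>)\<close> and the diameter a
  Lipschitz bound suffices because \<open>f\<close> is bounded below there.\<close>

lemma AE_deriv_le_below_diameter_imp_AE_deriv_le:
  assumes lip: "locally_lipschitz_on {0<..} f" and "\<tau> > 1"
    and der: "AE \<rho> in lborel. 0 < \<rho> \<and> ennreal \<rho> < ediameter (UNIV :: 'a set) / ennreal (2 * \<tau>) \<longrightarrow>
      f differentiable (at \<rho>) \<and> \<rho> * deriv f \<rho> \<le> C * f \<rho>"
  shows "\<exists>C. AE \<rho> in lborel. 0 < \<rho> \<longrightarrow> f differentiable (at \<rho>) \<and> \<rho> * deriv f \<rho> \<le> C * f \<rho>"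
proof (cases "ediameter (UNIV :: 'a set)")
  \<comment> \<open>In an unbounded space the threshold is infinite, so the hypothesis already
    covers all radii.\<close>
  case top
  then have "ediameter (UNIV :: 'a set) / ennreal (2 * \<tau>) = top"
    by (simp add: ennreal_top_divide)
  then show ?thesis using der by (intro exI[of _ C]) (auto elim!: eventually_mono)
next
  case (real d)
  have "mono_on {0<..} f" by (rule mono_onI) (simp add: f_mono)
  then have diff: "AE \<rho> in lborel. 0 < \<rho> \<longrightarrow> f differentiable (at \<rho>)"
    using lip by (rule AE_differentiable_mono_locally_lipschitz)
  have ball_UNIV: "ball x r = UNIV" if "d < r" for r
  proof -
    have "dist x y < r" for y
      using dist_le_ediameter[of x UNIV y] real that by (simp add: ennreal_le_iff)
    then show ?thesis by auto
  qed
  have beyond: "deriv f r = 0" if r: "d < r" for r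
  proof -
    have "((\<lambda>_. f r) has_real_derivative 0) (at r)" by simp
    then have "(f has_real_derivative 0) (at r)"
      by (rule has_field_derivative_transform_within_open[where S = "{d<..}"])
        (use r real in \<open>auto simp: f_eq ball_UNIV\<close>)
    then show ?thesis by (rule DERIV_imp_deriv)
  qed
  define d0 where "d0 = d / (2 * \<tau>)"
  have quot: "ediameter (UNIV :: 'a set) / ennreal (2 * \<tau>) = ennreal d0"
    using real \<open>\<tau> > 1\<close> by (simp add: d0_def divide_ennreal)
  have "\<exists>B. \<forall>r. 0 < r \<and> d0 \<le> r \<and> r \<le> d \<and> f differentiable (at r) \<longrightarrow> r * deriv f r \<le> B * f r"
  proof (cases "d > 0")
    case True
    then have d0: "d0 > 0" using \<open>\<tau> > 1\<close> by (simp add: d0_def)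
    \<comment> \<open>The margins \<open>d0 / 2\<close> and \<open>d + 1\<close> put all of
      \<open>[d0, d]\<close> in the interior, as the derivative bound requires.\<close>
    then have sub: "{d0 / 2..d + 1} \<subseteq> {0<..}" by auto
    obtain L where L: "L-lipschitz_on {d0 / 2..d + 1} f"
      by (rule locally_lipschitz_on_compact[OF lip compact_Icc sub])
    have L0: "L \<ge> 0" using L by (rule lipschitz_on_nonneg)
    show ?thesis
    proof (intro exI[of _ "d * L / f d0"] allI impI; elim conjE)
      fix r assume r: "0 < r" "d0 \<le> r" "r \<le> d" and "f differentiable (at r)"
      then have "(f has_real_derivative deriv f r) (at r)"
        by (simp add: DERIV_deriv_iff_real_differentiable)
      then have "deriv f r \<le> L"
        using r d0 by (intro lipschitz_on_derivative_le[OF L]) auto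
      then have "r * deriv f r \<le> r * L" using r by simp
      also have "\<dots> \<le> d * L" using r L0 by (intro mult_right_mono) auto
      also have "\<dots> = d * L / f d0 * f d0" using f_pos[OF d0] by simp
      also have "\<dots> \<le> d * L / f d0 * f r"
        using f_mono[OF d0 r(2)] True L0 f_pos[OF d0] by (intro mult_left_mono) auto
      finally show "r * deriv f r \<le> d * L / f d0 * f r" .
    qed
  qed (auto intro: exI[of _ 0])
  then obtain B where B: "\<And>r. \<lbrakk>0 < r; d0 \<le> r; r \<le> d; f differentiable (at r)\<rbrakk> \<Longrightarrow> r * deriv f r \<le> B * f r"
    by blast
  \<comment> \<open>The 0 in the maximum covers radii beyond the diameter, where the derivative
    vanishes.\<close>
  have "AE \<rho> in lborel. 0 < \<rho> \<longrightarrow> f differentiable (at \<rho>) \<and> \<rho> * deriv f \<rho> \<le> max (max B C) 0 * f \<rho>"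
    using der diff
  proof eventually_elim
    case (elim r)
    show ?case
    proof (intro impI conjI)
      assume r: "0 < r"
      with elim show df: "f differentiable (at r)" by blast
      have mono: "r * deriv f r \<le> max (max B C) 0 * f r" if "r * deriv f r \<le> c * f r" "c \<in> {B, C, 0}" for c
        using that f_pos[OF r] by (elim order_trans) (auto intro!: mult_right_mono)
      consider "r < d0" | "d0 \<le> r" "r \<le> d" | "d < r" by linarith
      then show "r * deriv f r \<le> max (max B C) 0 * f r"
      proof cases
        case 1
        then have "ennreal r < ediameter (UNIV :: 'a set) / ennreal (2 * \<tau>)"
          using r quot by (simp add: ennreal_less_iff)
        then show ?thesis using elim r by (intro mono[of C]) auto
      next
        case 2
        then show ?thesis using B r df by (intro mono[of B]) auto
      next
        case 3
        then show ?thesis using beyond by (intro mono[of 0]) auto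
      qed
    qed
  qed
  then show ?thesis by blast
qed

end

section \<open>The Poincare inequality for cutoff functions\<close>

text \<open>Take \<open>t\<close> as the first time at which \<open>\<phi>\<close> reaches
  \<open>b\<close>, and \<open>s\<close> as the last time before \<open>t\<close> at which it is at
  most \<open>a\<close>; the Lipschitz bound turns the rise into a duration. With
  \<open>\<phi>\<close> the distance to \<open>x\<close> along a curve, this bounds from below the
  time spent in an annulus.\<close>

lemma crossing_interval:
  fixes \<phi> :: "real \<Rightarrow> real"
  assumes lip: "1-lipschitz_on {0..l} \<phi>" and l: "0 \<le> l" and ab: "\<phi> 0 \<le> a" "a < b" "b \<le> \<phi> l"
  obtains s t where "0 \<le> s" "s \<le> t" "t \<le> l" "b - a \<le> t - s" "\<And>z. z \<in> {s<..<t} \<Longrightarrow> a < \<phi> z \<and> \<phi> z < b"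
proof -
  have cont: "continuous_on {0..l} \<phi>" using lip by (rule lipschitz_on_continuous_on)
  have sub: "{t \<in> {0..l}. P t} = {0..l} \<inter> {t \<in> {0..l}. P t}" for P by auto
  have "compact {t \<in> {0..l}. b \<le> \<phi> t}"
    by (subst sub) (intro compact_Int_closed continuous_on_closed_Collect_le continuous_intros cont; simp)
  moreover have "l \<in> {t \<in> {0..l}. b \<le> \<phi> t}" using l ab by simp
  ultimately obtain t where t: "t \<in> {0..l}" "b \<le> \<phi> t" "\<And>z. z \<in> {0..l} \<Longrightarrow> b \<le> \<phi> z \<Longrightarrow> t \<le> z"
    using compact_attains_inf[of "{t \<in> {0..l}. b \<le> \<phi> t}"] by blast
  have sub': "{s \<in> {0..l}. \<phi> s \<le> a} \<inter> {0..t} = {0..t} \<inter> {s \<in> {0..l}. \<phi> s \<le> a}" by auto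
  have "compact ({s \<in> {0..l}. \<phi> s \<le> a} \<inter> {0..t})"
    by (subst sub') (intro compact_Int_closed continuous_on_closed_Collect_le continuous_intros cont; simp)
  moreover have "0 \<in> {s \<in> {0..l}. \<phi> s \<le> a} \<inter> {0..t}" using l ab t by simp
  ultimately obtain s where s: "s \<in> {0..t}" "\<phi> s \<le> a" "\<And>z. z \<in> {0..l} \<Longrightarrow> \<phi> z \<le> a \<Longrightarrow> z \<in> {0..t} \<Longrightarrow> z \<le> s"
    using compact_attains_sup[of "{s \<in> {0..l}. \<phi> s \<le> a} \<inter> {0..t}"] by blast
  show ?thesis
  proof (rule that)
    show "0 \<le> s" "s \<le> t" "t \<le> l" using s t by auto
    have "b - a \<le> \<phi> t - \<phi> s" using s t by simp
    also have "\<dots> \<le> t - s"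
      using lipschitz_on_normD[OF lip, of t s] s t by simp
    finally show "b - a \<le> t - s" .
    fix z assume "z \<in> {s<..<t}"
    then show "a < \<phi> z \<and> \<phi> z < b"
      using s(1) s(3)[of z] t(1) t(3)[of z] by (auto simp: not_le[symmetric])
  qed
qed

text \<open>Negating \<open>\<phi>\<close> turns a descent into an ascent, with the levels becoming
  \<open>- b < - a\<close>.\<close>

lemma crossing_interval_unordered:
  fixes \<phi> :: "real \<Rightarrow> real"
  assumes lip: "1-lipschitz_on {0..l} \<phi>" and l: "0 \<le> l"
    and ab: "min (\<phi> 0) (\<phi> l) \<le> a" "a < b" "b \<le> max (\<phi> 0) (\<phi> l)"
  obtains s t where "0 \<le> s" "s \<le> t" "t \<le> l" "b - a \<le> t - s" "\<And>z. z \<in> {s<..<t} \<Longrightarrow> a < \<phi> z \<and> \<phi> z < b"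
proof (cases "\<phi> 0 \<le> \<phi> l")
  case True
  then have "\<phi> 0 \<le> a" "b \<le> \<phi> l" using ab by auto
  then show ?thesis
    by (rule crossing_interval[OF lip l _ ab(2)]) (rule that)
next
  case False
  then have neg: "- \<phi> 0 \<le> - b" "- b < - a" "- a \<le> - \<phi> l" using ab by auto
  have "1-lipschitz_on {0..l} (\<lambda>z. - \<phi> z)" using lip by (simp add: lipschitz_on_minus)
  then obtain s t where st: "0 \<le> s" "s \<le> t" "t \<le> l" "(- a) - (- b) \<le> t - s"
    "\<And>z. z \<in> {s<..<t} \<Longrightarrow> - b < - \<phi> z \<and> - \<phi> z < - a"
    using l neg by (rule crossing_interval) (rule that)
  show ?thesis
    by (rule that[OF st(1-3)]) (use st(4,5) in auto)
qed

text \<open>The two endpoints already form a partition, so length dominates distance.\<close>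

lemma arc_length_curve_lipschitz:
  assumes "arc_length_curve l c"
  shows "1-lipschitz_on {0..l} c"
proof (rule lipschitz_on_leI)
  fix s t :: real assume st: "s \<in> {0..l}" "t \<in> {0..l}" "s \<le> t"
  have "ennreal (dist (c s) (c t)) = (\<Sum>i<length [s, t] - 1. ennreal (dist (c ([s, t] ! i)) (c ([s, t] ! Suc i))))"
    by simp
  also have "\<dots> \<le> curve_length c s t"
    unfolding curve_length_def by (rule SUP_upper) (use st in auto)
  also have "\<dots> = ennreal (t - s)"
    using assms st by (auto simp: arc_length_curve_def)
  finally show "dist (c s) (c t) \<le> 1 * dist s t"
    using st by (simp add: ennreal_le_iff dist_real_def)
qed simp

definition cutoff :: "'a::metric_space \<Rightarrow> real \<Rightarrow> real \<Rightarrow> 'a \<Rightarrow> real" where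
  "cutoff x r h y = max 0 (min 1 ((r + h - dist x y) / h))"

text \<open>The cutoff is Lipschitz with constant \<open>1 / h\<close> everywhere, but the Poincare
  estimate needs a gradient that vanishes off the annulus. It suffices that a curve along which the
  cutoff changes by \<open>\<delta>\<close> spends time at least \<open>h * \<delta>\<close> there,
  and this is the crossing estimate for the distance to \<open>x\<close>.\<close>

lemma upper_gradient_cutoff:
  fixes x :: "'a::metric_space"
  assumes h: "h > 0"
  shows "upper_gradient (\<lambda>y. ennreal (1 / h) * indicator (ball x (r + h) - ball x r) y) (\<lambda>y. ereal (cutoff x r h y))"
  unfolding upper_gradient_def
proof (intro conjI allI impI)
  show "(\<lambda>y. ennreal (1 / h) * indicator (ball x (r + h) - ball x r) y) \<in> borel_measurable borel"
    by (intro borel_measurable_times_ennreal borel_measurable_const borel_measurable_indicator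
        sets.Diff borel_open open_ball)
  fix l and c :: "real \<Rightarrow> 'a" assume c: "arc_length_curve l c"
  then have l: "l > 0" by (simp add: arc_length_curve_def)
  define \<phi> where "\<phi> = (\<lambda>t. dist x (c t))"
  \<comment> \<open>\<open>[a, b]\<close> is the range between the distances of the two ends of the
    curve, cut down to \<open>[r, r + h]\<close>; if it is empty or a point, the cutoff agrees at
    both ends.\<close>
  define a where "a = max r (min (\<phi> 0) (\<phi> l))"
  define b where "b = min (r + h) (max (\<phi> 0) (\<phi> l))"
  have \<phi>_lip: "1-lipschitz_on {0..l} \<phi>"
  proof (rule lipschitz_onI)
    fix s t assume "s \<in> {0..l}" "t \<in> {0..l}"
    then have "dist (c s) (c t) \<le> 1 * dist s t"
      by (rule lipschitz_onD[OF arc_length_curve_lipschitz[OF c]])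
    then show "dist (\<phi> s) (\<phi> t) \<le> 1 * dist s t"
      using dist_triangle[of x "c s" "c t"] dist_triangle[of x "c t" "c s"]
      by (simp add: \<phi>_def dist_real_def dist_commute abs_le_iff)
  qed simp
  have clamp: "cutoff x r h (c t) = max 0 (min h (r + h - \<phi> t)) / h" for t
    using h by (auto simp: cutoff_def \<phi>_def max_def min_def field_simps)
  have "\<bar>max 0 (min h (r + h - \<phi> 0)) - max 0 (min h (r + h - \<phi> l))\<bar> \<le> max 0 (b - a)"
    using h unfolding a_def b_def by (smt (verit))
  then have "\<bar>max 0 (min h (r + h - \<phi> 0)) - max 0 (min h (r + h - \<phi> l))\<bar> / h \<le> max 0 (b - a) / h"
    using h by (intro divide_right_mono) auto
  then have diff: "\<bar>cutoff x r h (c 0) - cutoff x r h (c l)\<bar> \<le> max 0 (b - a) / h"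
    unfolding clamp diff_divide_distrib[symmetric] using h by (simp add: abs_divide)
  have "ennreal (max 0 (b - a) / h)
      \<le> (\<integral>\<^sup>+ t\<in>{0..l}. (ennreal (1 / h) * indicator (ball x (r + h) - ball x r) (c t)) \<partial>lborel)"
  proof (cases "a < b")
    case True
    obtain s t where st: "0 \<le> s" "s \<le> t" "t \<le> l" "b - a \<le> t - s" "\<And>z. z \<in> {s<..<t} \<Longrightarrow> a < \<phi> z \<and> \<phi> z < b"
      using crossing_interval_unordered[OF \<phi>_lip, of a b] l True by (auto simp: a_def b_def)
    have "ennreal (max 0 (b - a) / h) \<le> ennreal (1 / h * (t - s))"
      using st(2,4) h by (intro ennreal_leI) (auto simp: divide_right_mono)
    also have "\<dots> = ennreal (1 / h) * emeasure lborel {s<..<t}"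
      using st h by (subst ennreal_mult) auto
    also have "\<dots> = (\<integral>\<^sup>+ z. ennreal (1 / h) * indicator {s<..<t} z \<partial>lborel)"
      by (subst nn_integral_cmult_indicator) auto
    also have "\<dots> \<le> (\<integral>\<^sup>+ z\<in>{0..l}. (ennreal (1 / h) * indicator (ball x (r + h) - ball x r) (c z)) \<partial>lborel)"
    proof (intro nn_integral_mono)
      fix z :: real
      show "ennreal (1 / h) * indicator {s<..<t} z
        \<le> ennreal (1 / h) * indicator (ball x (r + h) - ball x r) (c z) * indicator {0..l} z"
      proof (cases "z \<in> {s<..<t}")
        case True
        then have "r < \<phi> z" "\<phi> z < r + h" using st(5)[of z] by (auto simp: a_def b_def)
        then have "c z \<in> ball x (r + h) - ball x r" by (simp add: \<phi>_def)
        moreover have "z \<in> {0..l}" using True st by auto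
        ultimately show ?thesis by (simp add: indicator_def)
      qed simp
    qed
    finally show ?thesis .
  qed simp
  with diff show "(if \<bar>ereal (cutoff x r h (c 0))\<bar> = \<infinity> \<or> \<bar>ereal (cutoff x r h (c l))\<bar> = \<infinity> then \<infinity>
        else e2ennreal \<bar>ereal (cutoff x r h (c 0)) - ereal (cutoff x r h (c l))\<bar>)
      \<le> (\<integral>\<^sup>+ t\<in>{0..l}. (ennreal (1 / h) * indicator (ball x (r + h) - ball x r) (c t)) \<partial>lborel)"
    by (auto intro: order_trans[OF ennreal_leI])
qed

context metric_measure_space
begin

lemma borel_measurable_continuous:
  fixes u :: "'a \<Rightarrow> 'b::topological_space"
  assumes "continuous_on UNIV u"
  shows "u \<in> borel_measurable M"
proof (rule borel_measurableI)
  fix S :: "'b set" assume "open S"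
  then have "open (u -` S)" using assms by (simp add: continuous_on_open_vimage)
  then have "u -` S \<in> sets M" by (intro subsetD[OF borel_subset] borel_open)
  then show "u -` S \<inter> space M \<in> sets M" by (simp add: space_eq)
qed

lemma integrable_cutoff:
  assumes h: "h > 0"
  shows "integrable_ereal M (\<lambda>y. ereal (cutoff x r h y))"
  unfolding integrable_ereal_def
proof
  have "continuous_on UNIV (cutoff x r h)"
    unfolding cutoff_def using h by (intro continuous_intros) auto
  then show "(\<lambda>y. ereal (cutoff x r h y)) \<in> borel_measurable M"
    by (intro borel_measurable_ereal borel_measurable_continuous)
  have "(\<integral>\<^sup>+ y. e2ennreal \<bar>ereal (cutoff x r h y)\<bar> \<partial>M) \<le> (\<integral>\<^sup>+ y. indicator (ball x (r + h)) y \<partial>M)"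
  proof (intro nn_integral_mono)
    fix y
    show "e2ennreal \<bar>ereal (cutoff x r h y)\<bar> \<le> indicator (ball x (r + h)) y"
    proof (cases "y \<in> ball x (r + h)")
      case True
      have "0 \<le> cutoff x r h y" "cutoff x r h y \<le> 1" by (auto simp: cutoff_def)
      then show ?thesis using True by simp
    next
      case False
      then have "cutoff x r h y = 0" using h by (simp add: cutoff_def divide_nonpos_pos)
      then show ?thesis by simp
    qed
  qed
  also have "\<dots> < \<infinity>" by (simp add: emeasure_ball)
  finally show "(\<integral>\<^sup>+ y. e2ennreal \<bar>ereal (cutoff x r h y)\<bar> \<partial>M) < \<infinity>" .
qed

end

context ball_growth
begin

text \<open>The cutoff is \<open>1\<close> on the ball of radius \<open>r\<close> and \<open>0\<close> on the annulus between \<open>r + h\<close> and \<open>R\<close>,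
  so no constant can be close to it on both sets.\<close>

lemma cutoff_deviation:
  assumes h: "h > 0" and r: "r > 0" "r + h \<le> R"
  shows "ennreal (min (f r) (f R - f (r + h)))
    \<le> (\<integral>\<^sup>+ y\<in>ball x R. e2ennreal \<bar>ereal (cutoff x r h y) - ereal m\<bar> \<partial>M)"
proof -
  define A where "A = ball x R - ball x (r + h)"
  have A: "A \<in> sets M" "emeasure M A = ennreal (f R - f (r + h))"
    using r h by (auto simp: A_def emeasure_annulus f_eq)
  have R: "f (r + h) \<le> f R" using r h by (intro f_mono) auto
  define k where "k = min (f r) (f R - f (r + h))"
  have k: "0 \<le> k" "k \<le> f r" "k \<le> f R - f (r + h)" using f_pos[OF r(1)] R by (auto simp: k_def)
  \<comment> \<open>Whatever \<open>m\<close> is,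
    \<open>1 \<le> \<bar>1 - m\<bar> + \<bar>m\<bar>\<close>, so the two sets, each of measure at
    least \<open>k\<close>, together contribute at least \<open>k\<close>.\<close>
  have "k * 1 \<le> k * (\<bar>1 - m\<bar> + \<bar>m\<bar>)" using k by (intro mult_left_mono) auto
  also have "\<dots> \<le> \<bar>1 - m\<bar> * f r + \<bar>m\<bar> * (f R - f (r + h))"
    using k unfolding distrib_left by (intro add_mono) (auto simp: mult.commute[of k] intro!: mult_left_mono)
  finally have "ennreal k \<le> ennreal (\<bar>1 - m\<bar> * f r + \<bar>m\<bar> * (f R - f (r + h)))"
    by (intro ennreal_leI) simp
  also have "\<dots> = ennreal \<bar>1 - m\<bar> * emeasure M (ball x r) + ennreal \<bar>m\<bar> * emeasure M A"
    using R r f_pos[OF r(1)] by (simp add: A emeasure_ball f_eq[symmetric] ennreal_mult)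
  also have "\<dots> = (\<integral>\<^sup>+ y. ennreal \<bar>1 - m\<bar> * indicator (ball x r) y + ennreal \<bar>m\<bar> * indicator A y \<partial>M)"
    using A by (subst nn_integral_add) (auto simp: nn_integral_cmult_indicator)
  also have "\<dots> \<le> (\<integral>\<^sup>+ y\<in>ball x R. e2ennreal \<bar>ereal (cutoff x r h y) - ereal m\<bar> \<partial>M)"
  proof (intro nn_integral_mono)
    fix y
    consider "y \<in> ball x r" | "y \<in> A" | "y \<notin> ball x r" "y \<notin> A" by blast
    then show "ennreal \<bar>1 - m\<bar> * indicator (ball x r) y + ennreal \<bar>m\<bar> * indicator A y
      \<le> e2ennreal \<bar>ereal (cutoff x r h y) - ereal m\<bar> * indicator (ball x R) y"
    proof cases
      case 1
      then have "cutoff x r h y = 1" using h by (simp add: cutoff_def)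
      moreover have "y \<notin> A" "y \<in> ball x R" using 1 h r by (auto simp: A_def)
      ultimately show ?thesis using 1 by simp
    next
      case 2
      then have "cutoff x r h y = 0" using h by (simp add: A_def cutoff_def divide_nonpos_pos)
      moreover have "y \<notin> ball x r" "y \<in> ball x R" using 2 h r by (auto simp: A_def)
      ultimately show ?thesis using 2 by simp
    qed simp
  qed
  finally show ?thesis by (simp add: k_def)
qed

text \<open>The gradient \<open>1 / h\<close> on the annulus integrates to the difference quotient
  of \<open>f\<close>. As \<open>C\<close> and \<open>\<Lambda>\<close> do not depend on
  \<open>h\<close>, the inequality survives the limit of \<open>h\<close> to 0.\<close>

lemma poincare_annulus_quotient:
  assumes "poincare_1_at M x"
  obtains C \<Lambda> where "C > 0" "\<Lambda> \<ge> 1"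
    "\<And>r h R. \<lbrakk>h > 0; r > 0; r + h \<le> R\<rbrakk> \<Longrightarrow>
      min (f r) (f R - f (r + h)) / f R \<le> C * R / f (\<Lambda> * R) * ((f (r + h) - f r) / h)"
proof -
  obtain C \<Lambda> where C: "C > 0" "\<Lambda> \<ge> 1" and P: "\<And>r u g. \<lbrakk>r > 0; integrable_ereal M u; upper_gradient g u\<rbrakk> \<Longrightarrow>
           (\<integral>\<^sup>+ y\<in>ball x r. e2ennreal \<bar>u y - ereal (mean_value M (ball x r) u)\<bar> \<partial>M)
               / emeasure M (ball x r)
             \<le> ennreal (C * r) *
               ((\<integral>\<^sup>+ y\<in>ball x (\<Lambda> * r). g y \<partial>M) / emeasure M (ball x (\<Lambda> * r)))"
    using assms unfolding poincare_1_at_def by blast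
  show ?thesis
  proof (rule that[OF C])
    fix r h R :: real assume h: "h > 0" and r: "r > 0" "r + h \<le> R"
    define u where "u = (\<lambda>y. ereal (cutoff x r h y))"
    define g where "g = (\<lambda>y. ennreal (1 / h) * indicator (ball x (r + h) - ball x r) y)"
    have R: "R > 0" using h r by simp
    then have \<Lambda>R: "\<Lambda> * R > 0" using C by simp
    note pos = f_pos[OF R] f_pos[OF \<Lambda>R] f_pos[OF r(1)]
    have le: "f (r + h) \<le> f R" "f r \<le> f (r + h)" using r h by (auto intro!: f_mono)
    have "(\<integral>\<^sup>+ y\<in>ball x (\<Lambda> * R). g y \<partial>M) \<le> (\<integral>\<^sup>+ y. g y \<partial>M)"
      by (intro nn_integral_mono) (simp add: indicator_def)
    also have "\<dots> = ennreal (1 / h) * emeasure M (ball x (r + h) - ball x r)"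
      unfolding g_def by (intro nn_integral_cmult_indicator) auto
    also have "\<dots> = ennreal ((f (r + h) - f r) / h)"
      using r h le by (simp add: emeasure_annulus f_eq[symmetric] ennreal_mult[symmetric])
    finally have g: "(\<integral>\<^sup>+ y\<in>ball x (\<Lambda> * R). g y \<partial>M) \<le> ennreal ((f (r + h) - f r) / h)" .
    have "ennreal (min (f r) (f R - f (r + h)) / f R) = ennreal (min (f r) (f R - f (r + h))) / emeasure M (ball x R)"
      using pos le R by (simp add: emeasure_ball f_eq[symmetric] divide_ennreal)
    also have "\<dots> \<le> (\<integral>\<^sup>+ y\<in>ball x R. e2ennreal \<bar>u y - ereal (mean_value M (ball x R) u)\<bar> \<partial>M) / emeasure M (ball x R)"
      unfolding u_def by (intro divide_right_mono_ennreal cutoff_deviation h r)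
    also have "\<dots> \<le> ennreal (C * R) * ((\<integral>\<^sup>+ y\<in>ball x (\<Lambda> * R). g y \<partial>M) / emeasure M (ball x (\<Lambda> * R)))"
      unfolding u_def g_def by (intro P R integrable_cutoff upper_gradient_cutoff h)
    also have "\<dots> \<le> ennreal (C * R) * (ennreal ((f (r + h) - f r) / h) / emeasure M (ball x (\<Lambda> * R)))"
      by (intro mult_left_mono divide_right_mono_ennreal g) auto
    also have "\<dots> = ennreal (C * R) * ennreal ((f (r + h) - f r) / h / f (\<Lambda> * R))"
      using pos le h \<Lambda>R by (simp add: emeasure_ball f_eq[symmetric] divide_ennreal)
    also have "\<dots> = ennreal (C * R / f (\<Lambda> * R) * ((f (r + h) - f r) / h))"
      using pos le h C R by (simp add: ennreal_mult[symmetric])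
    finally show "min (f r) (f R - f (r + h)) / f R \<le> C * R / f (\<Lambda> * R) * ((f (r + h) - f r) / h)"
      using pos le h C R by (subst (asm) ennreal_le_iff) auto
  qed
qed

lemma poincare_deriv_ge:
  assumes "poincare_1_at M x" "reverse_doubling_at M x \<tau>" "\<tau> > 1"
  obtains c where "c > 0"
    "\<And>r. \<lbrakk>r > 0; ennreal r \<le> ediameter (UNIV :: 'a set) / ennreal (2 * \<tau>); f differentiable (at r)\<rbrakk>
      \<Longrightarrow> c * f r \<le> r * deriv f r"
proof -
  obtain C \<Lambda> where C: "C > 0" "\<Lambda> \<ge> 1" and P: "\<And>r h R. \<lbrakk>h > 0; r > 0; r + h \<le> R\<rbrakk> \<Longrightarrow>
      min (f r) (f R - f (r + h)) / f R \<le> C * R / f (\<Lambda> * R) * ((f (r + h) - f r) / h)"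
    using poincare_annulus_quotient[OF assms(1)] by blast
  obtain \<gamma> where \<gamma>: "\<gamma> > 1" and rd: "\<And>r. \<lbrakk>r > 0; ennreal r \<le> ediameter (UNIV :: 'a set) / ennreal (2 * \<tau>)\<rbrakk>
      \<Longrightarrow> \<gamma> * measure M (ball x r) \<le> measure M (ball x (\<tau> * r))"
    using assms(2) unfolding reverse_doubling_at_def by blast
  show ?thesis
  proof (rule that)
    \<comment> \<open>\<open>min 1 (\<gamma> - 1)\<close> comes from the smaller of the inner ball
      and the annulus around it, each of measure at least that multiple of \<open>f r\<close>;
      \<open>C * \<tau>\<close> is the Poincare factor \<open>C * R\<close> divided by
      \<open>r\<close>.\<close>
    show "min 1 (\<gamma> - 1) / (C * \<tau>) > 0" using C \<gamma> assms(3) by simp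
    fix r assume r: "r > 0" "ennreal r \<le> ediameter (UNIV :: 'a set) / ennreal (2 * \<tau>)"
      and diff: "f differentiable (at r)"
    define R where "R = \<tau> * r"
    define D where "D = deriv f r"
    have R: "r < R" "R > 0" using r assms(3) by (auto simp: R_def)
    have D: "(f has_real_derivative D) (at r)"
      using diff by (simp add: D_def DERIV_deriv_iff_real_differentiable)
    have lim: "((\<lambda>h. (f (r + h) - f r) / h) \<longlongrightarrow> D) (at_right 0)"
      using D unfolding DERIV_def by (rule tendsto_within_subset) simp
    have lim_f: "((\<lambda>h. f (r + h)) \<longlongrightarrow> f r) (at_right 0)"
    proof -
      have "((\<lambda>h. f (r + h)) \<longlongrightarrow> f r) (at 0)"
        using DERIV_isCont[OF D] by (simp add: isCont_iff)
      then show ?thesis by (rule tendsto_within_subset) simp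
    qed
    have "min (f r) (f R - f r) / f R \<le> C * R / f (\<Lambda> * R) * D"
    proof (rule tendsto_le)
      show "((\<lambda>h. C * R / f (\<Lambda> * R) * ((f (r + h) - f r) / h)) \<longlongrightarrow> C * R / f (\<Lambda> * R) * D) (at_right 0)"
        by (intro tendsto_intros lim)
      show "((\<lambda>h. min (f r) (f R - f (r + h)) / f R) \<longlongrightarrow> min (f r) (f R - f r) / f R) (at_right 0)"
        using f_pos[OF R(2)] by (intro tendsto_intros tendsto_min lim_f) auto
      have "\<forall>\<^sub>F h in at_right 0. h \<in> {0<..<R - r}"
        using R by (intro eventually_at_right_real) simp
      then show "\<forall>\<^sub>F h in at_right 0. min (f r) (f R - f (r + h)) / f R \<le> C * R / f (\<Lambda> * R) * ((f (r + h) - f r) / h)"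
      proof eventually_elim
        case (elim h)
        then show ?case using r by (intro P) auto
      qed
    qed simp
    moreover have "min 1 (\<gamma> - 1) * f r \<le> min (f r) (f R - f r)"
    proof -
      have "\<gamma> * f r \<le> f R" using rd[OF r] r R by (simp add: f_eq R_def)
      moreover have "min 1 (\<gamma> - 1) * f r \<le> 1 * f r" "min 1 (\<gamma> - 1) * f r \<le> (\<gamma> - 1) * f r"
        using f_pos[OF r(1)] by (intro mult_right_mono; simp)+
      ultimately show ?thesis by (simp add: left_diff_distrib)
    qed
    ultimately have 1: "min 1 (\<gamma> - 1) * f r / f R \<le> C * R / f (\<Lambda> * R) * D"
      using f_pos[OF R(2)] by (meson divide_right_mono less_imp_le order_trans)
    have \<Lambda>R: "R \<le> \<Lambda> * R" using C R by simp
    have fs: "f R > 0" "f (\<Lambda> * R) > 0" "f R \<le> f (\<Lambda> * R)" "f r > 0"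
      using f_pos f_mono[OF R(2) \<Lambda>R] R \<Lambda>R r by auto
    \<comment> \<open>The sign of \<open>D\<close> is read off the inequality itself and allows the
      denominator to be lowered next.\<close>
    have "0 \<le> min 1 (\<gamma> - 1) * f r / f R" using \<gamma> fs by simp
    with 1 have "0 \<le> C * R / f (\<Lambda> * R) * D" by linarith
    moreover have "0 < C * R / f (\<Lambda> * R)" using C R fs by simp
    ultimately have "D \<ge> 0" by (meson mult_pos_neg not_le)
    have "C * R / f (\<Lambda> * R) * D \<le> C * R / f R * D"
      using C R fs \<open>D \<ge> 0\<close> by (intro mult_right_mono divide_left_mono) auto
    with 1 have "min 1 (\<gamma> - 1) * f r / f R \<le> C * R / f R * D" by (rule order_trans)
    then have "min 1 (\<gamma> - 1) * f r / f R * f R \<le> C * R / f R * D * f R"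
      using fs(1) by (intro mult_right_mono) auto
    then have "min 1 (\<gamma> - 1) * f r \<le> C * R * D"
      using fs(1) by simp
    then have "min 1 (\<gamma> - 1) * f r / (C * \<tau>) \<le> C * R * D / (C * \<tau>)"
      using C assms(3) by (intro divide_right_mono) auto
    also have "\<dots> = r * D"
      using C assms(3) by (simp add: R_def)
    finally show "min 1 (\<gamma> - 1) / (C * \<tau>) * f r \<le> r * deriv f r"
      by (simp add: D_def)
  qed
qed

end

section \<open>The cycle of implications between the four conditions\<close>

theorem theorem6p1:
  fixes M :: "'a::metric_space measure" and x0 :: 'a and f :: "real \<Rightarrow> real"
  assumes "metric_measure_space M"
    and "\<And>r. r > 0 \<Longrightarrow> f r = measure M (ball x0 r)"
  shows
    "(annular_decay_1_at M x0 \<longleftrightarrow>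
       locally_absolutely_continuous_on {0<..} f \<and>
       (\<exists>C. AE \<rho> in lborel. 0 < \<rho> \<longrightarrow> f differentiable (at \<rho>) \<and> \<rho> * deriv f \<rho> \<le> C * f \<rho>))
     \<and>
     (annular_decay_1_at M x0 \<longleftrightarrow>
       locally_lipschitz_on {0<..} f \<and>
       (\<exists>C. AE \<rho> in lborel. 0 < \<rho> \<longrightarrow> f differentiable (at \<rho>) \<and> \<rho> * deriv f \<rho> \<le> C * f \<rho>))
     \<and>
     (\<forall>\<tau>>1. reverse_doubling_at M x0 \<tau> \<and> poincare_1_at M x0 \<longrightarrow>
       (annular_decay_1_at M x0 \<longleftrightarrow>
         locally_lipschitz_on {0<..} f \<and>
         (\<exists>C\<ge>1. AE \<rho> in lborel.
            0 < \<rho> \<and> ennreal \<rho> < ediameter (UNIV :: 'a set) / ennreal (2 * \<tau>) \<longrightarrow>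
            f differentiable (at \<rho>) \<and>
            1 / C * f \<rho> \<le> \<rho> * deriv f \<rho> \<and> \<rho> * deriv f \<rho> \<le> C * f \<rho>)))"
  (is "(?a \<longleftrightarrow> ?ac \<and> ?B) \<and> (_ \<longleftrightarrow> ?lip \<and> _) \<and> (\<forall>\<tau>>1. ?H \<tau> \<longrightarrow> (_ \<longleftrightarrow> _ \<and> ?D \<tau>))")
proof -
  interpret ball_growth M x0 f
    using assms by (intro ball_growth.intro ball_growth_axioms.intro)
  have ac_a: "?a" if "?ac" "?B"
    using that AE_deriv_le_imp_annular_decay by blast
  have lip_ac: "?ac" if "?lip"
    using that by (rule locally_lipschitz_imp_locally_absolutely_continuous)
  have a_lip: "?lip \<and> ?B" if "?a"
    using annular_decay_imp_locally_lipschitz[OF that] annular_decay_imp_AE_deriv_le[OF that] by blast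
  \<comment> \<open>The upper bound in (d) is extended past the threshold
    \<open>diam X / (2 * \<tau>)\<close>, which leads back to (c).\<close>
  have D_B: "?B" if \<tau>: "\<tau> > 1" and lip: "?lip" and D: "?D \<tau>" for \<tau>
  proof -
    obtain C where "AE \<rho> in lborel. 0 < \<rho> \<and> ennreal \<rho> < ediameter (UNIV :: 'a set) / ennreal (2 * \<tau>) \<longrightarrow>
            f differentiable (at \<rho>) \<and> 1 / C * f \<rho> \<le> \<rho> * deriv f \<rho> \<and> \<rho> * deriv f \<rho> \<le> C * f \<rho>"
      using D by blast
    then have "AE \<rho> in lborel. 0 < \<rho> \<and> ennreal \<rho> < ediameter (UNIV :: 'a set) / ennreal (2 * \<tau>) \<longrightarrow>
            f differentiable (at \<rho>) \<and> \<rho> * deriv f \<rho> \<le> C * f \<rho>"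
      by eventually_elim blast
    then show ?thesis
      by (rule AE_deriv_le_below_diameter_imp_AE_deriv_le[OF lip \<tau>])
  qed
  have B_D: "?D \<tau>" if \<tau>: "\<tau> > 1" and H: "?H \<tau>" and "?B" for \<tau>
  proof -
    obtain C where C: "AE \<rho> in lborel. 0 < \<rho> \<longrightarrow> f differentiable (at \<rho>) \<and> \<rho> * deriv f \<rho> \<le> C * f \<rho>"
      using \<open>?B\<close> by blast
    obtain c where c: "c > 0"
      "\<And>r. \<lbrakk>r > 0; ennreal r \<le> ediameter (UNIV :: 'a set) / ennreal (2 * \<tau>); f differentiable (at r)\<rbrakk>
      \<Longrightarrow> c * f r \<le> r * deriv f r"
      using poincare_deriv_ge[of \<tau>] H \<tau> by blast
    \<comment> \<open>One constant serves both sides: \<open>1 / c\<close> puts \<open>1 / K\<close>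
      below \<open>c\<close>, and the 1 meets the lower limit imposed on the constant.\<close>
    define K where "K = max (max C (1 / c)) 1"
    have K: "K \<ge> 1" "K \<ge> C" "K \<ge> 1 / c" by (auto simp: K_def)
    then have "1 / K \<le> c" using c(1) by (simp add: field_simps)
    show ?thesis
    proof (intro exI[of _ K] conjI K(1))
      show "AE \<rho> in lborel. 0 < \<rho> \<and> ennreal \<rho> < ediameter (UNIV :: 'a set) / ennreal (2 * \<tau>) \<longrightarrow>
            f differentiable (at \<rho>) \<and> 1 / K * f \<rho> \<le> \<rho> * deriv f \<rho> \<and> \<rho> * deriv f \<rho> \<le> K * f \<rho>"
        using C
      proof eventually_elim
        case (elim r)
        show ?case
        proof (intro impI)
          assume r: "0 < r \<and> ennreal r < ediameter (UNIV :: 'a set) / ennreal (2 * \<tau>)"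
          then have d: "f differentiable (at r)" "r * deriv f r \<le> C * f r" using elim by auto
          have fr: "f r \<ge> 0" using f_pos[of r] r by simp
          have "1 / K * f r \<le> c * f r" "C * f r \<le> K * f r"
            using \<open>1 / K \<le> c\<close> K(2) fr by (intro mult_right_mono; simp)+
          moreover have "c * f r \<le> r * deriv f r" using r d c(2) by (simp add: less_imp_le)
          ultimately show "f differentiable (at r) \<and> 1 / K * f r \<le> r * deriv f r \<and> r * deriv f r \<le> K * f r"
            using d by linarith
        qed
      qed
    qed
  qed
  show ?thesis
    using ac_a lip_ac a_lip D_B B_D by blast
qed

end
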